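(* For $n\ge2$, the restriction of the meromorphic function $T(t_1,\ldots,t_n)$ to the hypersurface $t_1\cdots t_n=1$ vanishes identically.
   Context: Fix $q$, $0<|q|<1$. With $(a)_\infty=\prod_{j\ge0}(1-aq^j)$, $\Theta(x)=(q)_\infty^{-2}(x^{1/2}-x^{-1/2})(qx)_\infty(q/x)_\infty$ and $\Theta^{(k)}=(x\frac d{dx})^k\Theta$. Define $$T(t_1,\ldots,t_n)=\sum_{\sigma\in\mathfrak S(n)}\frac{\det\Big(\frac{\Theta^{(j-i+1)}(t_{\sigma(1)}\cdots t_{\sigma(n-j)})}{(j-i+1)!}\Big)_{i,j=1}^n}{\Theta(t_{\sigma(1)})\Theta(t_{\sigma(1)}t_{\sigma(2)})\cdots\Theta(t_{\sigma(1)}\cdots t_{\sigma(n-1)})},$$ where empty products equal $1$, $1/(-k)!:=0$ for $k\ge1$, and square roots of products are products of chosen square roots $t_i^{1/2}$. (Equivalently $T=\Theta(t_1\cdots t_n)\,U(t_1,\ldots,t_n)$ with $U$ the same sum with the extra factor $\Theta(t_{\sigma(1)}\cdots t_{\sigma(n)})$ in the denominator.) *)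

theory Defs
  imports "HOL-Analysis.Analysis" "Jordan_Normal_Form.Determinant"
begin

definition qpoch :: "complex \<Rightarrow> complex \<Rightarrow> complex" where
  "qpoch q a = (\<Prod>j. 1 - a * q ^ j)"

text \<open>Theta, written as a function of the chosen square root s = x^(1/2), x = s^2:
  Theta(x) = (q)_\<infinity>^(-2) (s - 1/s) (q x)_\<infinity> (q/x)_\<infinity>.\<close>
definition theta :: "complex \<Rightarrow> complex \<Rightarrow> complex" where
  "theta q s = (s - 1 / s) * qpoch q (q * s\<^sup>2) * qpoch q (q / s\<^sup>2) / (qpoch q q)\<^sup>2"

text \<open>Theta^(k) = (x d/dx)^k Theta; in the variable s (x = s^2) one has x d/dx = (s/2) d/ds.\<close>
primrec thetaD :: "complex \<Rightarrow> nat \<Rightarrow> complex \<Rightarrow> complex" where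
  "thetaD q 0 = theta q"
| "thetaD q (Suc k) = (\<lambda>s. s / 2 * deriv (thetaD q k) s)"

definition pprod :: "(nat \<Rightarrow> complex) \<Rightarrow> (nat \<Rightarrow> nat) \<Rightarrow> nat \<Rightarrow> complex" where
  "pprod s \<sigma> m = (\<Prod>k<m. s (\<sigma> k))"

text \<open>The n x n matrix (0-based i,j), entry Theta^(j-i+1)(t_sigma(1)...t_sigma(n-j')) / (j-i+1)!
  with j' = j+1, and 0 when j-i+1 < 0.\<close>
definition Tmat :: "complex \<Rightarrow> nat \<Rightarrow> (nat \<Rightarrow> complex) \<Rightarrow> (nat \<Rightarrow> nat) \<Rightarrow> complex mat" where
  "Tmat q n s \<sigma> = mat n n (\<lambda>(i, j).
      if i \<le> j + 1 then thetaD q (j + 1 - i) (pprod s \<sigma> (n - (j + 1))) / of_nat (fact (j + 1 - i))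
      else 0)"

definition Tfun :: "complex \<Rightarrow> nat \<Rightarrow> (nat \<Rightarrow> complex) \<Rightarrow> complex" where
  "Tfun q n s = (\<Sum>\<sigma> | \<sigma> permutes {..<n}.
      det (Tmat q n s \<sigma>) / (\<Prod>m\<in>{1..<n}. theta q (pprod s \<sigma> m)))"

end

theory Submission
  imports Defs "HOL-Complex_Analysis.Complex_Analysis" "HOL-Combinatorics.Multiset_Permutations"
    "HOL-Library.Nat_Bijection"
begin

text \<open>
  Write \<open>t\<^sub>i = exp (u\<^sub>i)\<close>, \<open>h(u) = \<Theta>(exp u)\<close>, \<open>E\<^sub>k = (-1)\<^sup>k h\<^sup>(\<^sup>k\<^sup>)\<close> and \<open>u\<^sub>B = \<Sum>\<^sub>i\<^sub>\<in>\<^sub>B u\<^sub>i\<close>. The matrix is Hessenberg, so its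
  determinant expands along chains of subsets; after summing over all permutations the factorials
  cancel and \<open>T(S) = h(u\<^sub>S) F(S)\<close>, where \<open>F\<close> is determined by \<open>F(\<emptyset>) = 1\<close> and
  \<open>\<Sum>\<^sub>B\<^sub>\<subseteq>\<^sub>S E\<^bsub>|S - B|\<^esub>(u\<^sub>B) F(B) = 0\<close> for nonempty \<open>S\<close>.

  The quasi-periodicity of \<open>h\<close> turns this recursion into the difference equation
  \<open>T(x + \<tau>, S) = \<Sum>\<^sub>A\<^sub>\<subseteq>\<^sub>S (-1)\<^bsup>|A|\<^esup> T(x + u\<^sub>A, S - A)\<close>, whose right-hand side merges variables. By induction on
  the number of variables \<open>T\<close> vanishes on \<open>u\<^sub>S = 0\<close> and is 1 on \<open>u\<^sub>S = -\<tau>\<close> for fewer variables, hence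
  \<open>z \<mapsto> T(z, c - z, u\<^sub>3, \<dots>, u\<^sub>n)\<close> with \<open>c = -u\<^sub>3 - \<dots> - u\<^sub>n\<close> is elliptic. For generic \<open>u\<^sub>3, \<dots>, u\<^sub>n\<close> its possible
  poles are at \<open>-u\<^sub>B\<close> modulo the lattice. They are removable: for \<open>B\<close> nonempty and proper by the
  induction hypothesis, and at \<open>z = 0\<close> and \<open>z = c\<close> because \<open>F(z, D) = F(D) / z + o(1)\<close>, which even shows that
  the function tends to 0 there. By Liouville it is 0; the nongeneric case follows by continuity.
\<close>

section \<open>Sums over subsets and the subset recursion\<close>

lemma finite_proper_subsets [simp]: "finite S \<Longrightarrow> finite {B. B \<subset> S}"
  by (rule finite_subset[of _ "Pow S"]) auto

text \<open>A proper subset of \<open>insert a S\<close> that avoids \<open>a\<close> may be all of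
  \<open>S\<close>, while one containing \<open>a\<close> must miss an element of \<open>S\<close>;
  hence one full and one proper sum.\<close>

lemma sum_Pow_insert_proper:
  assumes "finite S" "a \<notin> S"
  shows "(\<Sum>B | B \<subset> insert a S. f B) = (\<Sum>B\<in>Pow S. f B) + (\<Sum>B | B \<subset> S. f (insert a B))"
proof -
  have "B \<in> Pow S \<union> insert a ` {B. B \<subset> S}" if "B \<subset> insert a S" for B
  proof (cases "a \<in> B")
    case True
    then have "B = insert a (B - {a})" "B - {a} \<subset> S" using that assms by auto
    then show ?thesis by blast
  qed (use that in auto)
  then have "{B. B \<subset> insert a S} = Pow S \<union> insert a ` {B. B \<subset> S}"
    using assms by (intro equalityI subsetI) (blast, fastforce)
  then have "sum f {B. B \<subset> insert a S} = sum f (Pow S) + sum f (insert a ` {B. B \<subset> S})"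
    using assms by (simp, subst sum.union_disjoint) auto
  also have "sum f (insert a ` {B. B \<subset> S}) = (\<Sum>B | B \<subset> S. f (insert a B))"
    using assms by (subst sum.reindex) (auto simp: inj_on_def)
  finally show ?thesis .
qed

lemma sum_Pow_proper:
  assumes "finite S"
  shows "(\<Sum>B\<in>Pow S. f B) = f S + (\<Sum>B | B \<subset> S. f B)"
proof -
  have "Pow S = insert S {B. B \<subset> S}" by auto
  then show ?thesis using assms by (simp add: sum.insert)
qed

text \<open>Nested pairs \<open>A \<subseteq> B\<close> correspond to disjoint pairs through
  \<open>Y = B - A\<close>.\<close>

lemma sum_Pow_Pow_diff:
  assumes "finite S"
  shows "(\<Sum>B\<in>Pow S. \<Sum>A\<in>Pow B. f A (B - A)) = (\<Sum>A\<in>Pow S. \<Sum>Y\<in>Pow (S - A). f A Y)"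
proof -
  have fin: "B \<subseteq> S \<Longrightarrow> finite B" for B using assms by (rule rev_finite_subset)
  have "(\<Sum>B\<in>Pow S. \<Sum>A\<in>Pow B. f A (B - A)) = (\<Sum>(B, A)\<in>Sigma (Pow S) Pow. f A (B - A))"
    using assms fin by (subst sum.Sigma) auto
  also have "\<dots> = (\<Sum>(A, Y)\<in>Sigma (Pow S) (\<lambda>A. Pow (S - A)). f A Y)"
    by (rule sum.reindex_bij_witness[where i = "\<lambda>(A, Y). (A \<union> Y, A)" and j = "\<lambda>(B, A). (A, B - A)"])
       auto
  also have "\<dots> = (\<Sum>A\<in>Pow S. \<Sum>Y\<in>Pow (S - A). f A Y)"
    using assms by (subst sum.Sigma) auto
  finally show ?thesis .
qed

text \<open>The same reindexing; \<open>A \<union> Y\<close> misses an element of \<open>S\<close>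
  exactly when \<open>Y\<close> misses one of \<open>S - A\<close>.\<close>

lemma sum_proper_Pow_diff:
  assumes "finite S"
  shows "(\<Sum>B | B \<subset> S. \<Sum>A\<in>Pow B. f A (B - A)) = (\<Sum>A\<in>Pow S. \<Sum>Y | Y \<subset> S - A. f A Y)"
proof -
  have fin: "B \<subset> S \<Longrightarrow> finite B" for B using assms by (auto intro: finite_subset)
  have "(\<Sum>B | B \<subset> S. \<Sum>A\<in>Pow B. f A (B - A)) = (\<Sum>(B, A)\<in>Sigma {B. B \<subset> S} Pow. f A (B - A))"
    using assms fin by (subst sum.Sigma) auto
  also have "\<dots> = (\<Sum>(A, Y)\<in>Sigma (Pow S) (\<lambda>A. {Y. Y \<subset> S - A}). f A Y)"
    by (rule sum.reindex_bij_witness[where i = "\<lambda>(A, Y). (A \<union> Y, A)" and j = "\<lambda>(B, A). (A, B - A)"])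
       auto
  also have "\<dots> = (\<Sum>A\<in>Pow S. \<Sum>Y | Y \<subset> S - A. f A Y)"
    using assms by (subst sum.Sigma) auto
  finally show ?thesis .
qed

section \<open>Binomial sums and Moebius inversion on subsets\<close>

lemma sum_Pow_card_choose:
  fixes f :: "nat \<Rightarrow> 'a :: comm_semiring_1"
  assumes "finite X"
  shows "(\<Sum>C\<in>Pow X. f (card C)) = (\<Sum>j\<le>card X. of_nat (card X choose j) * f j)"
proof -
  have "(\<Sum>C\<in>Pow X. f (card C)) = (\<Sum>j\<le>card X. \<Sum>C | C \<in> Pow X \<and> card C = j. f (card C))"
    using assms by (intro sum.group[symmetric]) (auto intro: card_mono)
  also have "\<dots> = (\<Sum>j\<le>card X. of_nat (card X choose j) * f j)"
    using assms by (intro sum.cong refl) (simp add: n_subsets)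
  finally show ?thesis .
qed

lemma sum_Pow_minus_one:
  assumes "finite S" "S \<noteq> {}"
  shows "(\<Sum>A\<in>Pow S. (-1) ^ card A) = (0 :: 'a :: comm_ring_1)"
proof -
  have "(\<Sum>A\<in>Pow S. (-1) ^ card A) = (\<Sum>j\<le>card S. of_nat (card S choose j) * (-1::'a) ^ j)"
    by (rule sum_Pow_card_choose) fact
  also have "\<dots> = (\<Sum>j\<le>card S. (-1) ^ j * of_nat (card S choose j))"
    by (simp add: mult.commute)
  also have "\<dots> = 0"
    using assms by (intro choose_alternating_sum) (simp add: card_gt_0_iff)
  finally show ?thesis .
qed

text \<open>After regrouping by \<open>Y = D - A\<close>, the coefficient of \<open>P Y\<close> is
  an alternating sum over the subsets of \<open>S - Y\<close>, which is zero unless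
  \<open>Y = S\<close>.\<close>

lemma moebius_partial_sums:
  fixes P :: "'a set \<Rightarrow> 'b :: comm_ring_1"
  assumes "finite S"
  shows "(\<Sum>D\<in>Pow S. \<Sum>A\<in>Pow D. (-1) ^ card A * P (D - A)) = P S"
proof -
  have fin: "B \<subseteq> S \<Longrightarrow> finite B" for B using assms by (rule rev_finite_subset)
  have "(\<Sum>D\<in>Pow S. \<Sum>A\<in>Pow D. (-1) ^ card A * P (D - A)) =
        (\<Sum>A\<in>Pow S. \<Sum>Y\<in>Pow (S - A). (-1) ^ card A * P Y)"
    by (rule sum_Pow_Pow_diff) fact
  also have "\<dots> = (\<Sum>(A, Y)\<in>Sigma (Pow S) (\<lambda>A. Pow (S - A)). (-1) ^ card A * P Y)"
    using assms by (subst sum.Sigma) auto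
  also have "\<dots> = (\<Sum>(Y, A)\<in>Sigma (Pow S) (\<lambda>Y. Pow (S - Y)). (-1) ^ card A * P Y)"
    by (rule sum.reindex_bij_witness[where i = "\<lambda>(A, Y). (Y, A)" and j = "\<lambda>(B, A). (A, B)"]) auto
  also have "\<dots> = (\<Sum>Y\<in>Pow S. (\<Sum>A\<in>Pow (S - Y). (-1) ^ card A) * P Y)"
    using assms by (subst sum.Sigma[symmetric]) (auto simp: sum_distrib_right)
  also have "\<dots> = (\<Sum>Y\<in>Pow S. if Y = S then P S else 0)"
  proof (rule sum.cong[OF refl])
    fix Y assume "Y \<in> Pow S"
    then show "(\<Sum>A\<in>Pow (S - Y). (-1) ^ card A) * P Y = (if Y = S then P S else 0)"
      using assms by (cases "Y = S") (auto simp: sum_Pow_minus_one)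
  qed
  also have "\<dots> = P S" using assms by simp
  finally show ?thesis .
qed

text \<open>Abstracts the function h(z) = Theta(exp z), with \<open>\<tau>\<close> a logarithm of q
  and \<open>c\<close> equal to -q^(-1/2). Since 2 pi i is purely imaginary,
  \<open>Re \<tau> \<noteq> 0\<close> makes the two quasi-periods linearly independent over the
  reals.\<close>

locale theta_like =
  fixes h :: "complex \<Rightarrow> complex" and \<tau> c :: complex
  assumes holo: "h holomorphic_on UNIV"
    and odd: "h (- z) = - h z"
    and deriv_at_0: "deriv h 0 = 1"
    and antiperiod: "h (z + 2 * pi * \<i>) = - h z"
    and quasiperiod: "h (z + \<tau>) = c * exp (- z) * h z"
    and c_nonzero: "c \<noteq> 0"
    and Re_tau: "Re \<tau> \<noteq> 0"
    and zeros: "h z = 0 \<Longrightarrow> \<exists>k l :: int. z = of_int k * \<tau> + of_int l * (2 * pi * \<i>)"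
begin

text \<open>The sign is the one produced by the Hessenberg expansion. It also absorbs the signs of
  the derivatives of \<open>exp (- z)\<close>, so that a shift by \<open>\<tau>\<close> produces
  plain binomial coefficients, that is, a sum over subsets.\<close>

definition E :: "nat \<Rightarrow> complex \<Rightarrow> complex" where
  "E k z = (-1) ^ k * (deriv ^^ k) h z"

text \<open>In additive variables this is the sum U with the extra Theta(t_1...t_n) in the
  denominator, generated recursively over subsets. Infinite sets receive the default value
  1.\<close>

function F :: "(nat \<Rightarrow> complex) \<Rightarrow> nat set \<Rightarrow> complex" where
  "F u S = (if S = {} \<or> infinite S then 1
            else - (\<Sum>B | B \<subset> S. E (card (S - B)) (sum u B) * F u B) / h (sum u S))"
  by auto
termination
  by (relation "Wellfounded.measure (\<lambda>(u, S). card S)") (auto intro: psubset_card_mono)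

declare F.simps [simp del]

text \<open>The numerator of \<open>F u S\<close>: only sums over proper subsets occur in
  denominators, so it keeps its meaning where \<open>h (sum u S)\<close> vanishes.\<close>

definition T :: "(nat \<Rightarrow> complex) \<Rightarrow> nat set \<Rightarrow> complex" where
  "T u S = - (\<Sum>B | B \<subset> S. E (card (S - B)) (sum u B) * F u B)"

text \<open>The contribution to \<open>T u (insert a S)\<close> of the subsets avoiding
  \<open>a\<close>; it does not depend on \<open>u a\<close>.\<close>

definition P :: "(nat \<Rightarrow> complex) \<Rightarrow> nat set \<Rightarrow> complex" where
  "P u S = - (\<Sum>B\<in>Pow S. E (Suc (card (S - B))) (sum u B) * F u B)"

lemma F_empty [simp]: "F u {} = 1"
  by (simp add: F.simps)

lemma F_eq: "finite S \<Longrightarrow> S \<noteq> {} \<Longrightarrow> F u S = T u S / h (sum u S)"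
  by (subst F.simps) (simp add: T_def)

lemma F_cong: "(\<And>i. i \<in> S \<Longrightarrow> u i = v i) \<Longrightarrow> F u S = F v S"
proof (induction "card S" arbitrary: S rule: less_induct)
  case less
  show ?case
  proof (cases "S = {} \<or> infinite S")
    case False
    have "(\<Sum>B | B \<subset> S. E (card (S - B)) (sum u B) * F u B) =
          (\<Sum>B | B \<subset> S. E (card (S - B)) (sum v B) * F v B)"
    proof (intro sum.cong refl arg_cong2[where f = "(*)"] arg_cong[where f = "E _"])
      fix B assume B: "B \<in> {B. B \<subset> S}"
      show "F u B = F v B"
        using False B less.prems by (intro less.hyps) (auto intro: psubset_card_mono)
      fix i assume "i \<in> B" then show "u i = v i" using B less.prems by auto
    qed
    moreover have "sum u S = sum v S" using less.prems by (rule sum.cong[OF refl])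
    ultimately show ?thesis using False by (subst (1 2) F.simps) simp
  qed (auto simp: F.simps)
qed

lemma P_cong:
  assumes "\<And>i. i \<in> S \<Longrightarrow> u i = v i"
  shows "P u S = P v S"
  unfolding P_def using assms
  by (intro arg_cong[where f = uminus] sum.cong refl arg_cong2[where f = "(*)"]
        arg_cong[where f = "E _"] F_cong) auto

lemma E_0: "E 0 = h" by (auto simp: E_def)

lemma T_insert:
  assumes "finite S" "a \<notin> S"
  shows "T u (insert a S) =
    P u S - (\<Sum>B | B \<subset> S. E (card (S - B)) (u a + sum u B) * F u (insert a B))"
proof -
  have fin: "B \<subseteq> S \<Longrightarrow> finite B" for B using assms(1) by (rule rev_finite_subset)
  have 1: "E (card (insert a S - B)) (sum u B) * F u B = E (Suc (card (S - B))) (sum u B) * F u B"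
    if "B \<subseteq> S" for B
  proof -
    have "insert a S - B = insert a (S - B)" using that assms by auto
    then show ?thesis using assms by simp
  qed
  have 2: "E (card (insert a S - insert a B)) (sum u (insert a B)) * F u (insert a B) =
      E (card (S - B)) (u a + sum u B) * F u (insert a B)" if "B \<subset> S" for B
  proof -
    have "insert a S - insert a B = S - B" using that assms by auto
    moreover have "a \<notin> B" using that assms by auto
    ultimately show ?thesis using fin[of B] that by simp
  qed
  show ?thesis
    unfolding T_def P_def sum_Pow_insert_proper[OF assms] minus_add_distrib diff_conv_add_uminus
    by (intro arg_cong2[where f = "(+)"] arg_cong[where f = uminus] sum.cong refl) (use 1 2 in auto)
qed

lemma T_insert_upd:
  assumes "finite S" "a \<notin> S"
  shows "T (u(a := x)) (insert a S) =
    P u S - (\<Sum>B | B \<subset> S. E (card (S - B)) (x + sum u B) * F (u(a := x)) (insert a B))"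
proof -
  have "P (u(a := x)) S = P u S" using assms by (intro P_cong) auto
  moreover have "sum (u(a := x)) B = sum u B" if "B \<subset> S" for B
    using that assms by (intro sum.cong) auto
  ultimately show ?thesis using T_insert[OF assms, of "u(a := x)"] by simp
qed

lemma E_holo [holomorphic_intros]: "g holomorphic_on A \<Longrightarrow> (\<lambda>z. E k (g z)) holomorphic_on A"
proof -
  assume g: "g holomorphic_on A"
  have "E k holomorphic_on UNIV" unfolding E_def
    by (intro holomorphic_intros holomorphic_higher_deriv[OF holo]) auto
  then have "(E k \<circ> g) holomorphic_on A"
    by (intro holomorphic_on_compose_gen[OF g]) auto
  then show ?thesis by (simp add: o_def)
qed

section \<open>The difference equation for a shift by \<open>\<tau>\<close>\<close>

lemma E_shift_tau:
  "E k (z + \<tau>) = c * exp (- z) * (\<Sum>j\<le>k. of_nat (k choose j) * E j z)"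
proof -
  have "(deriv ^^ k) h (z + \<tau>) = (deriv ^^ k) (\<lambda>w. h (1 * w + \<tau>)) z"
    by (subst higher_deriv_compose_linear'[OF holo, of UNIV]) auto
  also have "(\<lambda>w. h (1 * w + \<tau>)) = (\<lambda>w. h w * (c * exp (- 1 * w)))"
    by (simp add: quasiperiod mult_ac)
  also have "(deriv ^^ k) \<dots> z = (\<Sum>i=0..k. of_nat (k choose i) * (deriv ^^ i) h z *
     (deriv ^^ (k - i)) (\<lambda>w. c * exp (- 1 * w)) z)"
    by (rule higher_deriv_mult[where S = UNIV]) (auto intro!: holo holomorphic_intros)
  also have "\<dots> = (\<Sum>i\<le>k. of_nat (k choose i) * (deriv ^^ i) h z * (c * ((- 1) ^ (k - i) * exp (- z))))"
  proof (intro sum.cong)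
    fix i assume "i \<in> {..k}"
    have "(deriv ^^ m) (\<lambda>w. c * exp (- 1 * w)) z = c * ((- 1) ^ m * exp (- z))" for m
    proof -
      have "(deriv ^^ m) (\<lambda>w. c * exp (- 1 * w)) z = c * (deriv ^^ m) (\<lambda>w. exp (- 1 * w)) z"
        by (rule higher_deriv_cmult[where A = UNIV]) (auto intro!: holomorphic_intros)
      also have "(deriv ^^ m) (\<lambda>w. exp (- 1 * w)) z = (-1) ^ m * (deriv ^^ m) exp (-1 * z)"
        by (rule higher_deriv_compose_linear[where S = UNIV and T = UNIV]) (auto intro!: holomorphic_intros)
      also have "(deriv ^^ m) exp (-1 * z) = exp (- z)"
      proof -
        have "deriv exp = (exp :: complex \<Rightarrow> complex)"
          by (intro ext DERIV_imp_deriv DERIV_exp)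
        then have "(deriv ^^ m) exp = (exp :: complex \<Rightarrow> complex)"
          by (induction m) simp_all
        then show ?thesis by simp
      qed
      finally show ?thesis .
    qed
    then show "of_nat (k choose i) * (deriv ^^ i) h z * (deriv ^^ (k - i)) (\<lambda>w. c * exp (- 1 * w)) z =
      of_nat (k choose i) * (deriv ^^ i) h z * (c * ((- 1) ^ (k - i) * exp (- z)))" by simp
  qed auto
  finally have "E k (z + \<tau>) = (-1) ^ k * (\<Sum>i\<le>k. of_nat (k choose i) * (deriv ^^ i) h z * (c * ((- 1) ^ (k - i) * exp (- z))))"
    by (simp add: E_def)
  also have "\<dots> = (\<Sum>i\<le>k. c * exp (- z) * (of_nat (k choose i) * E i z))"
    unfolding sum_distrib_left
  proof (intro sum.cong refl)
    fix i assume "i \<in> {..k}"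
    then have "(-1 :: complex) ^ k = (-1) ^ i * (-1) ^ (k - i)"
      by (simp flip: power_add)
    then have "(-1 :: complex) ^ k * (-1) ^ (k - i) = (-1) ^ i"
      by (simp add: mult.assoc flip: power_mult_distrib)
    then show "(- 1) ^ k * (of_nat (k choose i) * (deriv ^^ i) h z * (c * ((- 1) ^ (k - i) * exp (- z)))) =
      c * exp (- z) * (of_nat (k choose i) * E i z)"
      by (simp add: E_def algebra_simps)
  qed
  finally show ?thesis by (simp add: sum_distrib_left)
qed

lemma E_shift_tau_Pow:
  "finite X \<Longrightarrow> E (card X) (z + \<tau>) = c * exp (- z) * (\<Sum>C\<in>Pow X. E (card C) z)"
  by (simp add: E_shift_tau sum_Pow_card_choose[of X "\<lambda>k. E k z"])

text \<open>\<open>P u\<close> is independent of the variable at \<open>a\<close>, so it can be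
  expanded both at \<open>x + \<tau>\<close> and at the points \<open>x + sum u A\<close>. Moebius
  inversion of the first expansion, compared with the second, leaves the stated identity.\<close>

lemma T_shift_tau:
  assumes "finite S" "a \<notin> S" "\<And>B. B \<subset> S \<Longrightarrow> h (x + sum u B) \<noteq> 0"
  shows "T (u(a := x + \<tau>)) (insert a S) =
    (\<Sum>A\<in>Pow S. (-1) ^ card A * T (u(a := x + sum u A)) (insert a (S - A)))"
  using assms
proof (induction "card S" arbitrary: S rule: less_induct)
  case less
  note [simp] = \<open>finite S\<close>
  have fin [simp]: "B \<subseteq> S \<Longrightarrow> finite B" for B using \<open>finite S\<close> by (rule rev_finite_subset)
  have finp [simp]: "B \<subset> S \<Longrightarrow> finite B" for B using fin by blast
  let ?G = "\<lambda>x B. F (u(a := x)) (insert a B)"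
  let ?T = "\<lambda>x B. T (u(a := x)) (insert a B)"
  \<comment> \<open>Normalized so that, by quasi-periodicity, \<open>h (x + sum u B) * g B\<close>
    is the value of \<open>T\<close> on \<open>insert a B\<close> at
    \<open>x + \<tau>\<close>.\<close>
  define g where "g B = c * exp (- (x + sum u B)) * ?G (x + \<tau>) B" for B
  \<comment> \<open>\<open>Q\<close> is the Moebius inverse of \<open>P u\<close>. \<open>K\<close>
    is built so that its sums over subsets are also \<open>P u\<close>; hence the two will
    agree.\<close>
  define Q where "Q D = (\<Sum>A\<in>Pow D. (-1) ^ card A * P u (D - A))" for D
  define K where "K D = ?T (x + \<tau>) D + (\<Sum>B | B \<subset> D. E (card (D - B)) (x + sum u B) * g B)" for D
  have sumupd: "sum (u(a := y)) (insert a B) = y + sum u B" if "B \<subseteq> S" for y B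
  proof -
    have "a \<notin> B" using that less.prems by auto
    then have "sum (u(a := y)) B = sum u B" by (intro sum.cong) auto
    then show ?thesis using that \<open>a \<notin> B\<close> by simp
  qed
  have hg: "h (x + sum u B) * g B = ?T (x + \<tau>) B" if "B \<subset> S" for B
  proof -
    have "h (x + \<tau> + sum u B) = c * exp (- (x + sum u B)) * h (x + sum u B)"
      using quasiperiod[of "x + sum u B"] by (simp add: add_ac)
    moreover have "h (x + sum u B) \<noteq> 0" using less.prems that by blast
    ultimately show ?thesis using that sumupd[of B] c_nonzero
      by (simp add: F_eq g_def field_simps)
  qed
  \<comment> \<open>The induction hypothesis for \<open>B\<close>, divided by
    \<open>h (x + sum u B)\<close>: all merged terms have this same total, so each \<open>T\<close>
    turns into \<open>F\<close>.\<close>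
  have g: "g B = (\<Sum>A\<in>Pow B. (-1) ^ card A * ?G (x + sum u A) (B - A))" if "B \<subset> S" for B
  proof -
    have nz: "h (x + sum u B) \<noteq> 0" using less.prems that by blast
    have "h (x + sum u B) * g B = (\<Sum>A\<in>Pow B. (-1) ^ card A * ?T (x + sum u A) (B - A))"
      unfolding hg[OF that] using less.prems that
      by (intro less.hyps) (auto intro: psubset_card_mono)
    also have "\<dots> = (\<Sum>A\<in>Pow B. h (x + sum u B) * ((-1) ^ card A * ?G (x + sum u A) (B - A)))"
    proof (intro sum.cong refl)
      fix A assume A: "A \<in> Pow B"
      have "x + sum u A + sum u (B - A) = x + sum u B"
        using A that by (simp add: sum.subset_diff[of A B])
      moreover have "sum (u(a := x + sum u A)) (insert a (B - A)) = x + sum u A + sum u (B - A)"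
        using A that by (intro sumupd) auto
      ultimately have "sum (u(a := x + sum u A)) (insert a (B - A)) = x + sum u B" by (simp only:)
      then show "(-1) ^ card A * ?T (x + sum u A) (B - A) =
         h (x + sum u B) * ((-1) ^ card A * ?G (x + sum u A) (B - A))"
        using that A nz by (simp add: F_eq del: fun_upd_apply)
    qed
    finally show ?thesis using nz by (simp add: sum_distrib_left[symmetric])
  qed
  \<comment> \<open>Expansion of \<open>P u S'\<close> at \<open>x + \<tau>\<close>, with each
    shifted \<open>E\<close> spread over the subsets \<open>C\<close> of
    \<open>S' - B\<close>.\<close>
  have PK: "P u S' = (\<Sum>D\<in>Pow S'. K D)" if "S' \<subseteq> S" for S'
  proof -
    note [simp] = fin[OF that]
    have fin' [simp]: "B \<subseteq> S' \<Longrightarrow> finite B" for B using fin[OF that] by (rule rev_finite_subset)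
    \<comment> \<open>The case \<open>C = {}\<close> is separate because for \<open>B = S\<close>
      the factor \<open>h (x + sum u S)\<close> may vanish; there the value of \<open>T\<close>
      itself has to appear. For smaller \<open>B\<close> both forms agree by
      \<open>hg\<close>.\<close>
    define k where "k B C = (if C = {} then ?T (x + \<tau>) B else E (card C) (x + sum u B) * g B)"
      for B C :: "nat set"
    have KK: "K D = (\<Sum>B\<in>Pow D. k B (D - B))" if "D \<subseteq> S'" for D
    proof -
      have "(\<Sum>B | B \<subset> D. k B (D - B)) = (\<Sum>B | B \<subset> D. E (card (D - B)) (x + sum u B) * g B)"
        by (intro sum.cong) (auto simp: k_def)
      moreover have "k D (D - D) = ?T (x + \<tau>) D" by (simp add: k_def)
      ultimately show ?thesis using that by (simp add: sum_Pow_proper K_def)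
    qed
    have kk: "(\<Sum>C\<in>Pow (S' - B). k B C) = E (card (S' - B)) (x + \<tau> + sum u B) * ?G (x + \<tau>) B" if "B \<subset> S'" for B
    proof -
      have "(\<Sum>C\<in>Pow (S' - B). k B C) = (\<Sum>C\<in>Pow (S' - B). E (card C) (x + sum u B) * g B)"
      proof (intro sum.cong refl)
        fix C assume "C \<in> Pow (S' - B)"
        then show "k B C = E (card C) (x + sum u B) * g B"
          using hg[of B] that \<open>S' \<subseteq> S\<close> by (cases "C = {}") (auto simp: k_def E_0)
      qed
      also have "\<dots> = (c * exp (- (x + sum u B)) * (\<Sum>C\<in>Pow (S' - B). E (card C) (x + sum u B))) * ?G (x + \<tau>) B"
        by (simp add: sum_distrib_left sum_distrib_right g_def mult_ac)
      also have "\<dots> = E (card (S' - B)) (x + \<tau> + sum u B) * ?G (x + \<tau>) B"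
        by (subst E_shift_tau_Pow[symmetric]) (auto simp: add_ac)
      finally show ?thesis .
    qed
    have "a \<notin> S'" using that less.prems by auto
    have "(\<Sum>D\<in>Pow S'. K D) = (\<Sum>D\<in>Pow S'. \<Sum>B\<in>Pow D. k B (D - B))"
      using KK by (intro sum.cong) auto
    also have "\<dots> = (\<Sum>B\<in>Pow S'. \<Sum>C\<in>Pow (S' - B). k B C)"
      by (rule sum_Pow_Pow_diff) simp
    also have "\<dots> = (\<Sum>C\<in>Pow (S' - S'). k S' C) + (\<Sum>B | B \<subset> S'. \<Sum>C\<in>Pow (S' - B). k B C)"
      by (rule sum_Pow_proper) simp
    also have "(\<Sum>C\<in>Pow (S' - S'). k S' C) = ?T (x + \<tau>) S'" by (simp add: k_def)
    also have "(\<Sum>B | B \<subset> S'. \<Sum>C\<in>Pow (S' - B). k B C) =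
       (\<Sum>B | B \<subset> S'. E (card (S' - B)) (x + \<tau> + sum u B) * ?G (x + \<tau>) B)"
      using kk by (intro sum.cong) auto
    also have "?T (x + \<tau>) S' + \<dots> = P u S'"
      using T_insert_upd[of S' a u "x + \<tau>"] \<open>a \<notin> S'\<close> by simp
    finally show ?thesis ..
  qed
  \<comment> \<open>Equal sums over the subsets of every \<open>D\<close> force equal summands, by
    induction on the size of \<open>D\<close>.\<close>
  have KQ: "K D = Q D" if "D \<subseteq> S" for D
    using that
  proof (induction "card D" arbitrary: D rule: less_induct)
    case (less D)
    then have [simp]: "finite D" by simp
    have "K D + (\<Sum>B | B \<subset> D. K B) = P u D"
      using PK[OF less.prems] by (simp add: sum_Pow_proper)
    moreover have "Q D + (\<Sum>B | B \<subset> D. Q B) = P u D"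
      unfolding Q_def using moebius_partial_sums[of D "P u"] by (simp add: sum_Pow_proper)
    moreover have "(\<Sum>B | B \<subset> D. K B) = (\<Sum>B | B \<subset> D. Q B)"
      using less by (intro sum.cong refl less.hyps) (auto intro: psubset_card_mono)
    ultimately show ?case by (metis add_right_cancel)
  qed
  \<comment> \<open>Each \<open>P u (S - A)\<close> is expanded at its own point
    \<open>x + sum u A\<close>.\<close>
  have "Q S = (\<Sum>A\<in>Pow S. (-1) ^ card A * (?T (x + sum u A) (S - A) +
     (\<Sum>Y | Y \<subset> S - A. E (card (S - A - Y)) (x + sum u A + sum u Y) * ?G (x + sum u A) Y)))"
    unfolding Q_def
  proof (intro sum.cong refl arg_cong2[where f = "(*)"])
    fix A assume "A \<in> Pow S"
    show "P u (S - A) = ?T (x + sum u A) (S - A) +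
     (\<Sum>Y | Y \<subset> S - A. E (card (S - A - Y)) (x + sum u A + sum u Y) * ?G (x + sum u A) Y)"
      using less.prems by (subst T_insert_upd) auto
  qed
  also have "\<dots> = (\<Sum>A\<in>Pow S. (-1) ^ card A * ?T (x + sum u A) (S - A)) +
    (\<Sum>A\<in>Pow S. \<Sum>Y | Y \<subset> S - A. (-1) ^ card A * (E (card (S - A - Y)) (x + sum u A + sum u Y) * ?G (x + sum u A) Y))"
    by (simp add: distrib_left sum.distrib sum_distrib_left)
  also have "(\<Sum>A\<in>Pow S. \<Sum>Y | Y \<subset> S - A. (-1) ^ card A * (E (card (S - A - Y)) (x + sum u A + sum u Y) * ?G (x + sum u A) Y)) =
     (\<Sum>B | B \<subset> S. \<Sum>A\<in>Pow B. (-1) ^ card A * (E (card (S - A - (B - A))) (x + sum u A + sum u (B - A)) * ?G (x + sum u A) (B - A)))"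
    by (rule sum_proper_Pow_diff[symmetric]) simp
  \<comment> \<open>The argument \<open>x + sum u A + sum u (B - A)\<close> does not depend on
    \<open>A\<close>, so the inner sum is \<open>g B\<close>. The result is the same correction as
    in \<open>K S\<close> and cancels.\<close>
  also have "\<dots> = (\<Sum>B | B \<subset> S. E (card (S - B)) (x + sum u B) * g B)"
  proof (intro sum.cong refl)
    fix B assume B: "B \<in> {B. B \<subset> S}"
    then have "(\<Sum>A\<in>Pow B. (-1) ^ card A * (E (card (S - A - (B - A))) (x + sum u A + sum u (B - A)) * ?G (x + sum u A) (B - A))) =
       (\<Sum>A\<in>Pow B. E (card (S - B)) (x + sum u B) * ((-1) ^ card A * ?G (x + sum u A) (B - A)))"
    proof (intro sum.cong refl)
      fix A assume A: "A \<in> Pow B"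
      have 1: "S - A - (B - A) = S - B" using A by auto
      have 2: "x + sum u A + sum u (B - A) = x + sum u B"
        using A B by (simp add: sum.subset_diff[of A B])
      show "(-1) ^ card A * (E (card (S - A - (B - A))) (x + sum u A + sum u (B - A)) * ?G (x + sum u A) (B - A)) =
        E (card (S - B)) (x + sum u B) * ((-1) ^ card A * ?G (x + sum u A) (B - A))"
        unfolding 1 2 by (simp add: mult_ac)
    qed
    also have "\<dots> = E (card (S - B)) (x + sum u B) * g B"
      using g B by (simp add: sum_distrib_left)
    finally show "(\<Sum>A\<in>Pow B. (-1) ^ card A * (E (card (S - A - (B - A))) (x + sum u A + sum u (B - A)) * ?G (x + sum u A) (B - A))) = E (card (S - B)) (x + sum u B) * g B" .
  qed
  finally have "K S = (\<Sum>A\<in>Pow S. (-1) ^ card A * ?T (x + sum u A) (S - A)) +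
      (\<Sum>B | B \<subset> S. E (card (S - B)) (x + sum u B) * g B)"
    using KQ[of S] by (simp only: order_refl)
  then show ?case unfolding K_def by (rule add_right_imp_eq)
qed

end

section \<open>The Hessenberg determinant and sums over permutations\<close>

text \<open>The recursion says that a combination of columns with coefficients \<open>w\<close> has
  only its top entry nonzero. Replacing the last column by it and expanding there leaves a
  triangular minor.\<close>

lemma det_hessenberg:
  fixes e :: "nat \<Rightarrow> nat \<Rightarrow> 'a :: field" and w :: "nat \<Rightarrow> 'a"
  assumes "n \<ge> 1" and w0: "w 0 = 1"
    and rec: "\<And>m. 1 \<le> m \<Longrightarrow> m < n \<Longrightarrow> (\<Sum>l\<le>m. e (m - l) l * w l) = 0"
  shows "det (mat n n (\<lambda>(i, j). if i \<le> j + 1 then e (j + 1 - i) (n - (j + 1)) else 0)) =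
     (-1) ^ (n - 1) * (\<Sum>l<n. e (n - l) l * w l) * (\<Prod>m\<in>{1..<n}. e 0 m)"
proof -
  define M where "M = mat n n (\<lambda>(i, j). if i \<le> j + 1 then e (j + 1 - i) (n - (j + 1)) else 0)"
  \<comment> \<open>Unit upper triangular, since its corner entry is \<open>w 0 = 1\<close>. The
    reversal in \<open>w (n - 1 - i)\<close> matches the reversed prefix lengths in the columns of
    \<open>M\<close>.\<close>
  define R where "R = mat n n (\<lambda>(i, j). if j = n - 1 then w (n - 1 - i) else if i = j then 1 else 0 :: 'a)"
  have [simp]: "M \<in> carrier_mat n n" "R \<in> carrier_mat n n" by (auto simp: M_def R_def)
  have [simp]: "M * R \<in> carrier_mat n n" by (rule mult_carrier_mat[of _ _ n]) auto
  have "det R = prod_list (diag_mat R)"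
    by (rule det_upper_triangular[of _ n]) (auto simp: R_def)
  also have "\<dots> = 1"
    unfolding prod_list_diag_prod using w0 by (intro prod.neutral) (auto simp: R_def)
  finally have detR: "det R = 1" .
  have N: "(M * R) $$ (i, j) = (\<Sum>k<n. M $$ (i, k) * R $$ (k, j))" if "i < n" "j < n" for i j
    using that by (simp add: scalar_prod_def atLeast0LessThan M_def R_def)
  have N1: "(M * R) $$ (i, j) = M $$ (i, j)" if "i < n" "j < n - 1" for i j
  proof -
    have "(M * R) $$ (i, j) = (\<Sum>k<n. if k = j then M $$ (i, k) else 0)"
      unfolding N[OF that(1) less_le_trans[OF that(2) diff_le_self]]
      by (intro sum.cong refl) (use that in \<open>simp add: R_def\<close>)
    then show ?thesis using that by simp
  qed
  have N2: "(M * R) $$ (i, n - 1) = (\<Sum>l<n. if i \<le> n - l then e (n - l - i) l * w l else 0)"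
    if "i < n" for i
  proof -
    have "(M * R) $$ (i, n - 1) =
      (\<Sum>k<n. if i \<le> k + 1 then e (k + 1 - i) (n - (k + 1)) * w (n - 1 - k) else 0)"
      using that by (subst N) (auto intro!: sum.cong simp: R_def M_def)
    also have "\<dots> = (\<Sum>l<n. if i \<le> n - l then e (n - l - i) l * w l else 0)"
      by (rule sum.reindex_bij_witness[of _ "\<lambda>l. n - 1 - l" "\<lambda>l. n - 1 - l"]) auto
    finally show ?thesis .
  qed
  have N3: "(M * R) $$ (i, n - 1) = 0" if "i < n" "i > 0" for i
  proof -
    have "(M * R) $$ (i, n - 1) = (\<Sum>l<n. if i \<le> n - l then e (n - l - i) l * w l else 0)"
      using that by (intro N2)
    also have "\<dots> = (\<Sum>l\<le>n-i. e (n - i - l) l * w l)"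
      using that by (intro sum.mono_neutral_cong_right) (auto simp: add.commute)
    also have "\<dots> = 0" using that by (intro rec) auto
    finally show ?thesis .
  qed
  \<comment> \<open>Deleting the first row moves the subdiagonal entries \<open>e 0 m\<close> onto
    the diagonal.\<close>
  have dimD: "mat_delete (M * R) 0 (n - 1) \<in> carrier_mat (n - 1) (n - 1)"
    by (rule mat_delete_carrier) auto
  have D: "mat_delete (M * R) 0 (n - 1) $$ (i, j) = M $$ (Suc i, j)" if "i < n - 1" "j < n - 1" for i j
    using that N1[of "Suc i" j] by (simp add: mat_delete_def M_def R_def)
  have "det (mat_delete (M * R) 0 (n - 1)) = prod_list (diag_mat (mat_delete (M * R) 0 (n - 1)))"
  proof (rule det_upper_triangular[OF _ dimD], rule upper_triangularI)
    fix i j assume "j < i" "i < dim_row (mat_delete (M * R) 0 (n - 1))"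
    then show "mat_delete (M * R) 0 (n - 1) $$ (i, j) = 0"
      using dimD by (subst D) (auto simp: M_def)
  qed
  also have "\<dots> = (\<Prod>i\<in>{0..<n - 1}. mat_delete (M * R) 0 (n - 1) $$ (i, i))"
    unfolding prod_list_diag_prod carrier_matD(1)[OF dimD] ..
  also have "\<dots> = (\<Prod>i\<in>{0..<n - 1}. e 0 (n - (i + 1)))"
    by (intro prod.cong refl) (subst D, auto simp: M_def)
  also have "\<dots> = (\<Prod>m\<in>{1..<n}. e 0 m)"
    by (rule prod.reindex_bij_witness[of _ "\<lambda>l. n - 1 - l" "\<lambda>l. n - 1 - l"]) auto
  finally have detD: "det (mat_delete (M * R) 0 (n - 1)) = (\<Prod>m\<in>{1..<n}. e 0 m)" .
  have "det M = det (M * R)" by (subst det_mult[of _ n]) (auto simp: detR)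
  also have "\<dots> = (\<Sum>i<n. (M * R) $$ (i, n - 1) * cofactor (M * R) i (n - 1))"
    using assms(1) by (intro laplace_expansion_column[of _ n]) auto
  also have "\<dots> = (\<Sum>i<n. if i = 0 then (M * R) $$ (0, n - 1) * cofactor (M * R) 0 (n - 1) else 0)"
    using N3 by (intro sum.cong) auto
  also have "\<dots> = (M * R) $$ (0, n - 1) * cofactor (M * R) 0 (n - 1)"
    using assms(1) by simp
  also have "(M * R) $$ (0, n - 1) = (\<Sum>l<n. e (n - l) l * w l)"
    using assms(1) by (subst N2) auto
  also have "cofactor (M * R) 0 (n - 1) = (-1) ^ (n - 1) * (\<Prod>m\<in>{1..<n}. e 0 m)"
    unfolding cofactor_def detD by simp
  finally show ?thesis unfolding M_def by (simp add: mult_ac)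
qed

text \<open>A prefix \<open>ys\<close> with underlying set \<open>B\<close> is completed by an
  arbitrary ordering of \<open>S - B\<close>; this supplies the factorial that cancels the one in
  the matrix entries.\<close>

lemma sum_permutations_of_set_take:
  fixes f :: "'a list \<Rightarrow> 'b :: {comm_semiring_1, semiring_char_0}"
  assumes "finite S"
  shows "(\<Sum>xs\<in>permutations_of_set S. f (take l xs)) =
    (\<Sum>B | B \<subseteq> S \<and> card B = min l (card S). \<Sum>ys\<in>permutations_of_set B. fact (card (S - B)) * f ys)"
proof -
  let ?\<B> = "{B. B \<subseteq> S \<and> card B = min l (card S)}"
  have fin: "finite ?\<B>" using assms by simp
  have append_perm: "take l (ys @ zs) = ys \<and> drop l (ys @ zs) = zs"
    if "B \<subseteq> S" "card B = min l (card S)" "set ys = B" "distinct ys" "set zs = S - B" "distinct zs"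
    for B and ys zs :: "'a list"
  proof -
    have "length ys = min l (card S)" using that distinct_card[of ys] by simp
    moreover have "length zs = card S - card B"
      using that assms distinct_card[of zs] finite_subset[of B S] by (simp add: card_Diff_subset)
    ultimately show ?thesis using that(2) by (cases "l \<le> card S") auto
  qed
  have "(\<Sum>B\<in>?\<B>. \<Sum>ys\<in>permutations_of_set B. fact (card (S - B)) * f ys) =
    (\<Sum>B\<in>?\<B>. \<Sum>ys\<in>permutations_of_set B. \<Sum>zs\<in>permutations_of_set (S - B). f ys)"
    using assms by (intro sum.cong refl) simp
  also have "\<dots> = (\<Sum>(B, ys, zs)\<in>Sigma ?\<B> (\<lambda>B. permutations_of_set B \<times> permutations_of_set (S - B)). f ys)"
    unfolding sum.cartesian_product using fin by (subst sum.Sigma) auto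
  also have "\<dots> = (\<Sum>xs\<in>permutations_of_set S. f (take l xs))"
  proof (rule sum.reindex_bij_witness[where j = "\<lambda>(B, ys, zs). ys @ zs"
      and i = "\<lambda>xs. (set (take l xs), take l xs, drop l xs)"], goal_cases)
    case (1 x)
    obtain B ys zs where x: "x = (B, ys, zs)" by (cases x)
    with 1 have B: "B \<subseteq> S" "card B = min l (card S)" "set ys = B" "distinct ys" "set zs = S - B" "distinct zs"
      by (auto simp: permutations_of_set_def)
    then have "take l (ys @ zs) = ys \<and> drop l (ys @ zs) = zs" by (rule append_perm)
    then show ?case using B x by simp
  next
    case (2 x)
    then show ?case using assms by (auto simp: permutations_of_set_def)
  next
    case (3 xs)
    then show ?case by simp
  next
    case (4 xs)
    then have xs: "set xs = S" "distinct xs" by (auto simp: permutations_of_set_def)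
    then have len: "length xs = card S" using distinct_card by force
    have "card (set (take l xs)) = min l (card S)"
      using xs len distinct_card[of "take l xs"] by (simp add: min.commute)
    moreover have "set (take l xs) \<subseteq> S" using xs set_take_subset by fast
    moreover have "set (drop l xs) = S - set (take l xs)"
    proof -
      have "set (take l xs) \<inter> set (drop l xs) = {}"
        using xs(2) by (simp add: set_take_disj_set_drop_if_distinct)
      moreover have "set (take l xs) \<union> set (drop l xs) = S"
        using xs(1) by (metis append_take_drop_id set_append)
      ultimately show ?thesis by blast
    qed
    ultimately show ?case using xs by (auto simp: permutations_of_set_def)
  next
    case (5 x)
    obtain B ys zs where x: "x = (B, ys, zs)" by (cases x)
    with 5 have B: "B \<subseteq> S" "card B = min l (card S)" "set ys = B" "distinct ys" "set zs = S - B" "distinct zs"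
      by (auto simp: permutations_of_set_def)
    show ?case using x append_perm[OF B] by simp
  qed
  finally show ?thesis ..
qed

text \<open>Surjectivity follows from injectivity because both sides have the same
  cardinality.\<close>

lemma image_permutes_permutations_of_set:
  "inj_on (\<lambda>\<sigma>. map \<sigma> [0..<n]) {\<sigma>. \<sigma> permutes {..<n}}" (is "inj_on ?g _")
  "(\<lambda>\<sigma>. map \<sigma> [0..<n]) ` {\<sigma>. \<sigma> permutes {..<n}} = permutations_of_set {..<n}"
proof -
  show inj: "inj_on ?g {\<sigma>. \<sigma> permutes {..<n}}"
  proof (rule inj_onI, rule ext)
    fix \<sigma> \<rho> :: "nat \<Rightarrow> nat" and x
    assume "\<sigma> \<in> {\<sigma>. \<sigma> permutes {..<n}}" "\<rho> \<in> {\<sigma>. \<sigma> permutes {..<n}}" "?g \<sigma> = ?g \<rho>"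
    then show "\<sigma> x = \<rho> x" by (cases "x < n") (auto simp: permutes_def)
  qed
  have "?g ` {\<sigma>. \<sigma> permutes {..<n}} \<subseteq> permutations_of_set {..<n}"
    by (auto simp: permutations_of_set_def distinct_map permutes_inj_on atLeast0LessThan permutes_image
        simp flip: image_image)
  moreover have "card (?g ` {\<sigma>. \<sigma> permutes {..<n}}) = card (permutations_of_set {..<n})"
    using inj by (simp add: card_image card_permutations)
  ultimately show "?g ` {\<sigma>. \<sigma> permutes {..<n}} = permutations_of_set {..<n}"
    by (intro card_subset_eq) auto
qed

lemma sum_permutes_permutations_of_set:
  "(\<Sum>\<sigma> | \<sigma> permutes {..<n}. f (map \<sigma> [0..<n])) = (\<Sum>xs\<in>permutations_of_set {..<n}. f xs)"
  using sum.reindex[OF image_permutes_permutations_of_set(1)[of n], of f]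
  by (simp add: image_permutes_permutations_of_set(2))

context theta_like
begin

text \<open>The contribution of a single ordering to \<open>F\<close>. Its recursion runs over
  prefixes, hence along one chain of subsets, and carries the factorials of the matrix
  entries.\<close>

function W :: "(nat \<Rightarrow> complex) \<Rightarrow> nat list \<Rightarrow> complex" where
  "W u xs = (if xs = [] then 1
     else - (\<Sum>l<length xs. E (length xs - l) (\<Sum>x\<leftarrow>take l xs. u x) / fact (length xs - l) * W u (take l xs))
          / h (\<Sum>x\<leftarrow>xs. u x))"
  by auto
termination
  by (relation "Wellfounded.measure (\<lambda>(u, xs). length xs)") auto

declare W.simps [simp del]

definition V :: "(nat \<Rightarrow> complex) \<Rightarrow> nat list \<Rightarrow> complex" where
  "V u xs = - (\<Sum>l<length xs. E (length xs - l) (\<Sum>x\<leftarrow>take l xs. u x) / fact (length xs - l) * W u (take l xs))"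

lemma W_Nil [simp]: "W u [] = 1" by (simp add: W.simps)

lemma W_eq: "xs \<noteq> [] \<Longrightarrow> W u xs = V u xs / h (\<Sum>x\<leftarrow>xs. u x)"
  by (subst W.simps) (simp add: V_def)

text \<open>Grouping the orderings by their prefix of length \<open>l\<close> cancels
  \<open>fact (n - l)\<close>. The relation between \<open>F\<close> and \<open>W\<close> on smaller
  sets is an assumption so that the lemma can serve inside the induction proving that
  relation.\<close>

lemma T_eq_sum_V_aux:
  assumes "finite S" and IH: "\<And>B. B \<subset> S \<Longrightarrow> F u B = (\<Sum>xs\<in>permutations_of_set B. W u xs)"
  shows "T u S = (\<Sum>xs\<in>permutations_of_set S. V u xs)"
proof -
  define n where "n = card S"
  have "(\<Sum>xs\<in>permutations_of_set S. V u xs) =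
     - (\<Sum>xs\<in>permutations_of_set S. \<Sum>l<n. E (n - l) (\<Sum>x\<leftarrow>take l xs. u x) / fact (n - l) * W u (take l xs))"
    unfolding V_def sum_negf n_def
    using length_finite_permutations_of_set by (intro arg_cong[where f = uminus] sum.cong) auto
  also have "(\<Sum>xs\<in>permutations_of_set S. \<Sum>l<n. E (n - l) (\<Sum>x\<leftarrow>take l xs. u x) / fact (n - l) * W u (take l xs)) =
     (\<Sum>l<n. \<Sum>xs\<in>permutations_of_set S. E (n - l) (\<Sum>x\<leftarrow>take l xs. u x) / fact (n - l) * W u (take l xs))"
    by (rule sum.swap)
  also have "\<dots> = (\<Sum>l<n. \<Sum>B | B \<subset> S \<and> card B = l. E (card (S - B)) (sum u B) * F u B)"
  proof (intro sum.cong refl)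
    fix l assume l: "l \<in> {..<n}"
    have "(\<Sum>xs\<in>permutations_of_set S. E (n - l) (\<Sum>x\<leftarrow>take l xs. u x) / fact (n - l) * W u (take l xs)) =
      (\<Sum>B | B \<subseteq> S \<and> card B = min l (card S). \<Sum>ys\<in>permutations_of_set B. fact (card (S - B)) *
         (E (n - l) (\<Sum>x\<leftarrow>ys. u x) / fact (n - l) * W u ys))"
      by (rule sum_permutations_of_set_take) fact
    also have "{B. B \<subseteq> S \<and> card B = min l (card S)} = {B. B \<subset> S \<and> card B = l}"
      using l assms(1) by (auto simp: n_def)
    also have "(\<Sum>B | B \<subset> S \<and> card B = l. \<Sum>ys\<in>permutations_of_set B. fact (card (S - B)) *
         (E (n - l) (\<Sum>x\<leftarrow>ys. u x) / fact (n - l) * W u ys)) =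
         (\<Sum>B | B \<subset> S \<and> card B = l. E (card (S - B)) (sum u B) * F u B)"
    proof (intro sum.cong refl)
      fix B assume B: "B \<in> {B. B \<subset> S \<and> card B = l}"
      then have c: "card (S - B) = n - l"
        using assms(1) by (auto simp: n_def card_Diff_subset finite_subset)
      have "(\<Sum>ys\<in>permutations_of_set B. fact (card (S - B)) * (E (n - l) (\<Sum>x\<leftarrow>ys. u x) / fact (n - l) * W u ys)) =
        (\<Sum>ys\<in>permutations_of_set B. E (n - l) (sum u B) * W u ys)"
      proof (intro sum.cong refl)
        fix ys assume "ys \<in> permutations_of_set B"
        then have "(\<Sum>x\<leftarrow>ys. u x) = sum u B"
          by (auto simp: permutations_of_set_def sum_list_distinct_conv_sum_set)
        then show "fact (card (S - B)) * (E (n - l) (\<Sum>x\<leftarrow>ys. u x) / fact (n - l) * W u ys) =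
          E (n - l) (sum u B) * W u ys" by (simp add: c)
      qed
      then show "(\<Sum>ys\<in>permutations_of_set B. fact (card (S - B)) * (E (n - l) (\<Sum>x\<leftarrow>ys. u x) / fact (n - l) * W u ys)) =
        E (card (S - B)) (sum u B) * F u B"
        using B IH[of B] by (simp add: c sum_distrib_left)
    qed
    finally show "(\<Sum>xs\<in>permutations_of_set S. E (n - l) (\<Sum>x\<leftarrow>take l xs. u x) / fact (n - l) * W u (take l xs)) =
       (\<Sum>B | B \<subset> S \<and> card B = l. E (card (S - B)) (sum u B) * F u B)" .
  qed
  also have "\<dots> = (\<Sum>l<n. \<Sum>B | B \<in> {B. B \<subset> S} \<and> card B = l. E (card (S - B)) (sum u B) * F u B)"
    by simp
  also have "\<dots> = (\<Sum>B | B \<subset> S. E (card (S - B)) (sum u B) * F u B)"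
    using assms(1) by (intro sum.group) (auto simp: n_def intro: psubset_card_mono)
  finally show ?thesis by (simp add: T_def)
qed

lemma F_eq_sum_W:
  assumes "finite S"
  shows "F u S = (\<Sum>xs\<in>permutations_of_set S. W u xs)"
  using assms
proof (induction "card S" arbitrary: S rule: less_induct)
  case less
  show ?case
  proof (cases "S = {}")
    case False
    have "T u S = (\<Sum>xs\<in>permutations_of_set S. V u xs)"
      using less by (intro T_eq_sum_V_aux less) (auto intro: psubset_card_mono finite_subset)
    then have "F u S = (\<Sum>xs\<in>permutations_of_set S. V u xs / h (sum u S))"
      using less.prems False by (simp add: F_eq sum_divide_distrib)
    also have "\<dots> = (\<Sum>xs\<in>permutations_of_set S. W u xs)"
    proof (intro sum.cong refl)
      fix xs assume "xs \<in> permutations_of_set S"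
      then have "(\<Sum>x\<leftarrow>xs. u x) = sum u S" "xs \<noteq> []" using False
        by (auto simp: permutations_of_set_def sum_list_distinct_conv_sum_set)
      then show "V u xs / h (sum u S) = W u xs" by (simp add: W_eq)
    qed
    finally show ?thesis .
  qed simp
qed

lemma T_eq_sum_V: "finite S \<Longrightarrow> T u S = (\<Sum>xs\<in>permutations_of_set S. V u xs)"
  by (rule T_eq_sum_V_aux) (auto intro: F_eq_sum_W finite_subset)

text \<open>Instance of the Hessenberg formula with \<open>w l = (-1) ^ l * W u (take l xs)\<close>;
  the alternating sign turns derivatives of \<open>h\<close> into \<open>E\<close>, and the defining
  recursion of \<open>W\<close> supplies the column relation.\<close>

lemma det_eq_V:
  assumes "xs \<noteq> []" "\<And>m. 1 \<le> m \<Longrightarrow> m < length xs \<Longrightarrow> h (\<Sum>x\<leftarrow>take m xs. u x) \<noteq> 0"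
  defines "n \<equiv> length xs"
  shows "det (mat n n (\<lambda>(i, j). if i \<le> j + 1
       then (deriv ^^ (j + 1 - i)) h (\<Sum>x\<leftarrow>take (n - (j + 1)) xs. u x) / fact (j + 1 - i) else 0)) =
     V u xs * (\<Prod>m\<in>{1..<n}. h (\<Sum>x\<leftarrow>take m xs. u x))"
proof -
  define p where "p m = (\<Sum>x\<leftarrow>take m xs. u x)" for m
  define w where "w l = (-1) ^ l * W u (take l xs)" for l
  have sgn: "(-1) ^ (m - l) * (-1) ^ l = (-1 :: complex) ^ m" if "l \<le> m" for m l :: nat
    using that by (simp flip: power_add)
  have Vm: "V u (take m xs) = - (\<Sum>l<m. (-1) ^ m * ((deriv ^^ (m - l)) h (p l) / fact (m - l) * w l))"
    if "m \<le> n" for m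
  proof -
    have "V u (take m xs) = - (\<Sum>l<m. E (m - l) (p l) / fact (m - l) * W u (take l xs))"
      using that by (auto simp: V_def n_def p_def min_absorb1 min_absorb2 intro!: sum.cong)
    also have "(\<Sum>l<m. E (m - l) (p l) / fact (m - l) * W u (take l xs)) =
        (\<Sum>l<m. (-1) ^ m * ((deriv ^^ (m - l)) h (p l) / fact (m - l) * w l))"
    proof (intro sum.cong refl)
      fix l assume "l \<in> {..<m}"
      then have "(-1 :: complex) ^ m = (-1) ^ (m - l) * (-1) ^ l" by (simp add: sgn)
      then show "E (m - l) (p l) / fact (m - l) * W u (take l xs) =
        (-1) ^ m * ((deriv ^^ (m - l)) h (p l) / fact (m - l) * w l)"
        by (simp add: E_def w_def mult_ac)
    qed
    finally show ?thesis .
  qed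
  have "det (mat n n (\<lambda>(i, j). if i \<le> j + 1
       then (deriv ^^ (j + 1 - i)) h (p (n - (j + 1))) / fact (j + 1 - i) else 0)) =
     (-1) ^ (n - 1) * (\<Sum>l<n. (deriv ^^ (n - l)) h (p l) / fact (n - l) * w l) *
     (\<Prod>m\<in>{1..<n}. (deriv ^^ 0) h (p m) / fact 0)"
  proof (rule det_hessenberg)
    show "1 \<le> n" using assms(1) by (cases xs) (auto simp: n_def)
    show "w 0 = 1" by (simp add: w_def)
  next
    fix m assume m: "1 \<le> m" "m < n"
    then have "h (p m) \<noteq> 0" "take m xs \<noteq> []" using assms(1,2) by (auto simp: n_def p_def)
    then have "h (p m) * W u (take m xs) = V u (take m xs)"
      by (simp add: W_eq p_def)
    then have "h (p m) * W u (take m xs) + (-1) ^ m * (\<Sum>l<m. (deriv ^^ (m - l)) h (p l) / fact (m - l) * w l) = 0"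
      using m by (simp add: Vm sum_distrib_left)
    then have "(-1) ^ m * (h (p m) * W u (take m xs) + (-1) ^ m * (\<Sum>l<m. (deriv ^^ (m - l)) h (p l) / fact (m - l) * w l)) = 0"
      by simp
    then have "h (p m) * w m + (\<Sum>l<m. (deriv ^^ (m - l)) h (p l) / fact (m - l) * w l) = 0"
      by (simp add: w_def algebra_simps)
    moreover have "{..m} = insert m {..<m}" by auto
    ultimately show "(\<Sum>l\<le>m. (deriv ^^ (m - l)) h (p l) / fact (m - l) * w l) = 0"
      by simp
  qed
  also have "(-1) ^ (n - 1) * (\<Sum>l<n. (deriv ^^ (n - l)) h (p l) / fact (n - l) * w l) = V u xs"
  proof -
    have "(-1 :: complex) ^ n = - ((-1) ^ (n - 1))" using assms(1) by (cases n) (auto simp: n_def)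
    then show ?thesis using Vm[of n] by (simp add: n_def sum_distrib_left sum_negf)
  qed
  finally show ?thesis unfolding p_def by simp
qed

end

section \<open>Quasi-periodicity on the hyperplanes\<close>

text \<open>The difference quotient at 0 has a removable singularity; it is taken twice.\<close>

lemma entire_double_zero_factor:
  assumes "f holomorphic_on UNIV" "f 0 = 0" "deriv f 0 = 0"
  obtains g where "g holomorphic_on UNIV" "\<And>z. f z = z ^ 2 * g z"
proof -
  define f1 where "f1 = (\<lambda>z. if z = 0 then deriv f 0 else (f z - f 0) / (z - 0))"
  have f1: "f1 holomorphic_on UNIV" unfolding f1_def by (rule pole_lemma_open) (use assms in auto)
  define f2 where "f2 = (\<lambda>z. if z = 0 then deriv f1 0 else (f1 z - f1 0) / (z - 0))"
  have f2: "f2 holomorphic_on UNIV" unfolding f2_def by (rule pole_lemma_open) (use f1 in auto)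
  have "f z = z ^ 2 * f2 z" for z
    using assms by (auto simp: f1_def f2_def power2_eq_square)
  with f2 that show thesis by blast
qed

text \<open>The cofactor of \<open>z ^ 2\<close> in an odd function is odd, hence zero at the
  origin: a double zero is automatically triple.\<close>

lemma entire_odd_double_zero:
  assumes "f holomorphic_on UNIV" "\<And>z. f (- z) = - f z" "deriv f 0 = 0"
  shows "((\<lambda>z. f z / z ^ 2) \<longlongrightarrow> 0) (at 0)"
proof -
  have "f 0 = 0" using assms(2)[of 0] by simp
  with assms obtain g where g: "g holomorphic_on UNIV" "\<And>z. f z = z ^ 2 * g z"
    using entire_double_zero_factor by blast
  have g_cont: "isCont g z" for z
    using g(1) holomorphic_on_imp_continuous_on continuous_on_eq_continuous_at by blast
  have "g (- z) + g z = 0" if "z \<noteq> 0" for z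
    using assms(2)[of z] that by (simp add: g(2) eq_neg_iff_add_eq_0 flip: distrib_left)
  then have "((\<lambda>z. g (- z) + g z) \<longlongrightarrow> 0) (at 0)"
    by (intro tendsto_eventually) (auto simp: eventually_at_filter)
  moreover have "((\<lambda>z. g (- z) + g z) \<longlongrightarrow> g (- 0) + g 0) (at 0)"
    by (intro tendsto_add isCont_tendsto_compose[OF g_cont] tendsto_intros)
  ultimately have "g (- 0) + g 0 = 0"
    by (intro tendsto_unique[of "at (0::complex)"]) auto
  then have "g 0 = 0" by simp
  then have "(g \<longlongrightarrow> 0) (at 0)" using g_cont[of 0] by (simp add: isCont_def)
  moreover have "eventually (\<lambda>z. g z = f z / z ^ 2) (at 0)"
    by (auto simp: eventually_at_filter g(2))
  ultimately show ?thesis by (rule Lim_transform_eventually)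
qed

context theta_like
begin

lemma h_0 [simp]: "h 0 = 0" using odd[of 0] by simp

lemma h_tau_eq_0_iff: "h (z + \<tau>) = 0 \<longleftrightarrow> h z = 0"
  using c_nonzero by (simp add: quasiperiod)

lemma h_holo [holomorphic_intros]: "g holomorphic_on A \<Longrightarrow> (\<lambda>z. h (g z)) holomorphic_on A"
  using E_holo[of g A 0] by (simp add: E_0)

lemma E_has_deriv: "(E k has_field_derivative - E (Suc k) z) (at z)"
proof -
  have "E k holomorphic_on UNIV" using E_holo[of "\<lambda>z. z" UNIV k] by simp
  then have "(E k has_field_derivative deriv (E k) z) (at z)"
    by (intro holomorphic_derivI) auto
  moreover have "deriv (E k) z = (-1) ^ k * deriv ((deriv ^^ k) h) z"
  proof -
    have "(deriv ^^ k) h field_differentiable at z"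
      using holomorphic_higher_deriv[OF holo, of k] holomorphic_on_imp_differentiable_at by blast
    then show ?thesis
      unfolding E_def[abs_def] by (rule deriv_cmult)
  qed
  ultimately show ?thesis by (simp add: E_def)
qed

lemma E_Suc_0_0: "E (Suc 0) 0 = - 1"
  by (simp add: E_def deriv_at_0)

lemma E_cont: "isCont (E k) z"
  using E_has_deriv by (rule DERIV_isCont)

lemma h_over_z: "((\<lambda>z. h z / z) \<longlongrightarrow> 1) (at 0)"
  using E_has_deriv[of 0 0] by (simp add: E_0 E_Suc_0_0 has_field_derivative_iff)

lemma E_shift_sign:
  assumes "\<And>z. h (z + \<omega>) = s * h z"
  shows "E k (z + \<omega>) = s * E k z"
proof -
  have "(deriv ^^ k) h (z + \<omega>) = (deriv ^^ k) (\<lambda>w. h (1 * w + \<omega>)) z"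
    by (subst higher_deriv_compose_linear'[OF holo, of UNIV]) auto
  also have "(\<lambda>w. h (1 * w + \<omega>)) = (\<lambda>w. s * h w)" by (simp add: assms)
  also have "(deriv ^^ k) \<dots> z = s * (deriv ^^ k) h z"
    by (rule higher_deriv_cmult[where A = UNIV]) (auto intro!: holo)
  finally show ?thesis by (simp add: E_def)
qed

lemma sum_fun_upd_add:
  fixes u :: "nat \<Rightarrow> complex"
  assumes "finite B"
  shows "sum (u(a := u a + y)) B = sum u B + (if a \<in> B then y else 0)"
proof (cases "a \<in> B")
  case True
  then have "B = insert a (B - {a})" by auto
  moreover have "sum (u(a := u a + y)) (B - {a}) = sum u (B - {a})" by (intro sum.cong) auto
  ultimately show ?thesis using True assms by (simp add: sum.remove)
next
  case False
  then show ?thesis by (auto intro!: sum.cong)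
qed

text \<open>In each summand of \<open>T\<close> the factors \<open>E\<close> and
  \<open>F u B\<close> acquire the same sign, and the square of the sign is 1.\<close>

lemma F_T_shift_sign:
  assumes "\<And>z. h (z + \<omega>) = s * h z" "s * s = 1" "finite S"
  shows "F (u(a := u a + \<omega>)) S = (if a \<in> S then s else 1) * F u S \<and> T (u(a := u a + \<omega>)) S = T u S"
  using assms(3)
proof (induction "card S" arbitrary: S rule: less_induct)
  case less
  have "s \<noteq> 0" using assms(2) by auto
  then have "1 / s = s" using assms(2) by (simp add: divide_eq_eq)
  have s: "x / (s * y) = s * (x / y)" for x y
  proof -
    have "x / (s * y) = 1 / s * (x / y)" by simp
    then show ?thesis by (simp only: \<open>1 / s = s\<close>)
  qed
  have T: "T (u(a := u a + \<omega>)) S = T u S"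
    unfolding T_def
  proof (intro arg_cong[where f = uminus] sum.cong refl)
    fix B assume B: "B \<in> {B. B \<subset> S}"
    then have fin: "finite B" using less.prems by (auto intro: finite_subset)
    have "F (u(a := u a + \<omega>)) B = (if a \<in> B then s else 1) * F u B"
      using B less.prems fin less.hyps[of B] psubset_card_mono[of S B] by blast
    then show "E (card (S - B)) (sum (u(a := u a + \<omega>)) B) * F (u(a := u a + \<omega>)) B =
       E (card (S - B)) (sum u B) * F u B"
      using assms(2) by (simp add: sum_fun_upd_add fin E_shift_sign[OF assms(1)] del: fun_upd_apply)
  qed
  have "F (u(a := u a + \<omega>)) S = (if a \<in> S then s else 1) * F u S"
  proof (cases "S = {}")
    case False
    then show ?thesis using less.prems T s
      by (simp add: F_eq sum_fun_upd_add assms(1) s del: fun_upd_apply)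
  qed simp
  with T show ?case by blast
qed

lemma T_singleton [simp]: "T u {a} = 1"
proof -
  have "{B. B \<subset> {a}} = {{}}" by auto
  then show ?thesis by (simp add: T_def E_Suc_0_0)
qed

section \<open>Holomorphy away from vanishing partial sums\<close>

lemma F_holo:
  assumes "finite S" "\<And>i. i \<in> S \<Longrightarrow> (\<lambda>z. U z i) holomorphic_on A"
    and "\<And>z B. z \<in> A \<Longrightarrow> B \<subseteq> S \<Longrightarrow> B \<noteq> {} \<Longrightarrow> h (sum (U z) B) \<noteq> 0"
  shows "(\<lambda>z. F (U z) S) holomorphic_on A"
  using assms
proof (induction "card S" arbitrary: S rule: less_induct)
  case less
  show ?case
  proof (cases "S = {}")
    case False
    have "(\<lambda>z. T (U z) S / h (sum (U z) S)) holomorphic_on A"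
      unfolding T_def
    proof (intro holomorphic_intros)
      fix B assume "B \<in> {B. B \<subset> S}"
      then show "(\<lambda>z. F (U z) B) holomorphic_on A"
        using less.prems by (intro less.hyps) (auto intro: psubset_card_mono finite_subset)
    qed (use less.prems False in auto)
    then show ?thesis using less.prems False by (simp add: F_eq)
  qed simp
qed

lemma T_holo:
  assumes "finite S" "\<And>i. i \<in> S \<Longrightarrow> (\<lambda>z. U z i) holomorphic_on A"
    and "\<And>z B. z \<in> A \<Longrightarrow> B \<subset> S \<Longrightarrow> B \<noteq> {} \<Longrightarrow> h (sum (U z) B) \<noteq> 0"
  shows "(\<lambda>z. T (U z) S) holomorphic_on A"
  unfolding T_def using assms
  by (intro holomorphic_intros F_holo) (auto intro: finite_subset)

text \<open>These are the denominators that occur in \<open>T u S\<close>. The full set is excluded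
  because on the hypersurface its sum is a zero of \<open>h\<close>.\<close>

definition good :: "(nat \<Rightarrow> complex) \<Rightarrow> nat set \<Rightarrow> bool" where
  "good u S \<longleftrightarrow> (\<forall>B. B \<subset> S \<longrightarrow> B \<noteq> {} \<longrightarrow> h (sum u B) \<noteq> 0)"

lemma goodD: "good u S \<Longrightarrow> B \<subset> S \<Longrightarrow> B \<noteq> {} \<Longrightarrow> h (sum u B) \<noteq> 0"
  by (auto simp: good_def)

lemma open_good:
  assumes "finite S" "\<And>i. i \<in> S \<Longrightarrow> (\<lambda>z. U z i) holomorphic_on UNIV"
  shows "open {z. good (U z) S}"
proof -
  have "{z. good (U z) S} = (\<Inter>B\<in>{B. B \<subset> S \<and> B \<noteq> {}}. {z. h (sum (U z) B) \<noteq> 0})"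
    by (auto simp: good_def)
  moreover have "open {z. h (sum (U z) B) \<noteq> 0}" if "B \<subset> S" for B
  proof -
    have "(\<lambda>z. h (sum (U z) B)) holomorphic_on UNIV"
      using that assms(2) by (intro holomorphic_intros) auto
    then have "continuous_on UNIV (\<lambda>z. h (sum (U z) B))"
      by (rule holomorphic_on_imp_continuous_on)
    then show ?thesis using open_Collect_neq[of "\<lambda>z. h (sum (U z) B)" "\<lambda>_. 0"] by simp
  qed
  ultimately show ?thesis
    using assms(1) by (auto intro!: open_INT finite_subset[of "{B. B \<subset> S \<and> B \<noteq> {}}" "Pow S"])
qed

lemma good_shift_tau:
  assumes "good u S" "finite S"
  shows "good (u(a := u a + \<tau>)) S"
  unfolding good_def
proof (intro allI impI)
  fix B assume "B \<subset> S" "B \<noteq> {}"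
  then show "h (sum (u(a := u a + \<tau>)) B) \<noteq> 0"
    using assms goodD[of u S B] finite_subset[of B S]
    by (simp add: sum_fun_upd_add h_tau_eq_0_iff del: fun_upd_apply)
qed

lemma good_shift_tau':
  assumes "good u S" "finite S"
  shows "good (u(a := u a - \<tau>)) S"
  unfolding good_def
proof (intro allI impI)
  fix B assume B: "B \<subset> S" "B \<noteq> {}"
  have "h (sum u B - \<tau>) = 0 \<longleftrightarrow> h (sum u B) = 0" using h_tau_eq_0_iff[of "sum u B - \<tau>"] by simp
  then show "h (sum (u(a := u a - \<tau>)) B) \<noteq> 0"
    using B assms goodD[of u S B] finite_subset[of B S] sum_fun_upd_add[of B u a "- \<tau>"]
    by (simp del: fun_upd_apply)
qed

lemma sum_merge:
  fixes u :: "nat \<Rightarrow> complex"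
  assumes "finite S" "a \<notin> S" "A \<subseteq> S"
  shows "sum (u(a := u a + sum u A)) (insert a (S - A)) = sum u (insert a S)"
proof -
  have "sum (u(a := u a + sum u A)) (S - A) = sum u (S - A)"
    using assms by (intro sum.cong) auto
  then show ?thesis using assms by (simp add: sum.subset_diff[of A S])
qed

text \<open>A partial sum of the merged variables is a partial sum of the original ones: a set
  containing \<open>a\<close> stands for its union with \<open>A\<close>, and any other set is
  unchanged.\<close>

lemma good_merge:
  assumes "finite S" "a \<notin> S" "A \<subseteq> S" "good u (insert a S)"
  shows "good (u(a := u a + sum u A)) (insert a (S - A))"
  unfolding good_def
proof (intro allI impI)
  fix B assume B: "B \<subset> insert a (S - A)" "B \<noteq> {}"
  show "h (sum (u(a := u a + sum u A)) B) \<noteq> 0"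
  proof (cases "a \<in> B")
    case True
    define C where "C = (B - {a}) \<union> A"
    have C: "C \<subset> S" "C - A = B - {a}" "A \<subseteq> C" using B True assms by (auto simp: C_def)
    have "sum (u(a := u a + sum u A)) (insert a (C - A)) = sum u (insert a C)"
      using C assms by (intro sum_merge) (auto intro: finite_subset)
    moreover have "insert a (C - A) = B" using True C by auto
    moreover have "insert a C \<subset> insert a S" using C assms by auto
    ultimately show ?thesis using goodD[OF assms(4)] by auto
  next
    case False
    then have "sum (u(a := u a + sum u A)) B = sum u B" by (intro sum.cong) auto
    moreover have "B \<subset> insert a S" using B False by auto
    ultimately show ?thesis using goodD[OF assms(4)] B by auto
  qed
qed

section \<open>Inductive statements on the hyperplanes with total 0 and
  \<open>- \<tau>\<close>\<close>

definition vanishing_below :: "nat \<Rightarrow> bool" where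
  "vanishing_below n \<longleftrightarrow> (\<forall>u S. finite S \<longrightarrow> 2 \<le> card S \<longrightarrow> card S < n \<longrightarrow> sum u S = 0 \<longrightarrow> good u S \<longrightarrow> T u S = 0)"

definition one_below :: "nat \<Rightarrow> bool" where
  "one_below n \<longleftrightarrow> (\<forall>u S. finite S \<longrightarrow> 1 \<le> card S \<longrightarrow> card S < n \<longrightarrow> sum u S = - \<tau> \<longrightarrow> good u S \<longrightarrow> T u S = 1)"

text \<open>Merging preserves the total \<open>- \<tau>\<close>, so every term of the difference
  equation with nonempty \<open>A\<close> has value 1 up to its sign. As the full alternating sum is
  0, these terms add up to -1, while \<open>A = {}\<close> gives \<open>T u S\<close>.\<close>

lemma T_shift_tau_step:
  assumes one: "one_below n" and S: "finite S" "2 \<le> card S" "card S \<le> n"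
    and u: "sum u S = - \<tau>" "good u S" and a: "a \<in> S"
  shows "T (u(a := u a + \<tau>)) S = T u S - 1"
proof -
  define R where "R = S - {a}"
  have R: "S = insert a R" "a \<notin> R" "finite R" using a S by (auto simp: R_def)
  have ne: "R \<noteq> {}" using S R by auto
  have nz: "h (u a + sum u B) \<noteq> 0" if "B \<subset> R" for B
  proof -
    have "a \<notin> B" "finite B" using that R by (auto intro: finite_subset)
    moreover have "insert a B \<subset> S" using that R by auto
    ultimately show ?thesis using goodD[OF u(2), of "insert a B"] by simp
  qed
  have "T (u(a := u a + \<tau>)) S =
    (\<Sum>A\<in>Pow R. (-1) ^ card A * T (u(a := u a + sum u A)) (insert a (R - A)))"
    unfolding R(1) using R nz by (intro T_shift_tau) auto
  also have "\<dots> = (\<Sum>A\<in>Pow R. (-1) ^ card A * (1 + (if A = {} then T u S - 1 else 0)))"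
  proof (intro sum.cong refl arg_cong2[where f = "(*)"])
    fix A assume A: "A \<in> Pow R"
    show "T (u(a := u a + sum u A)) (insert a (R - A)) = 1 + (if A = {} then T u S - 1 else 0)"
    proof (cases "A = {}")
      case False
      have "card (insert a (R - A)) < card S"
        using A False R by (intro psubset_card_mono) auto
      moreover have "sum (u(a := u a + sum u A)) (insert a (R - A)) = - \<tau>"
        using A R u by (subst sum_merge) auto
      moreover have "good (u(a := u a + sum u A)) (insert a (R - A))"
        using A R u by (intro good_merge) auto
      moreover have "card (insert a (R - A)) \<ge> 1" using R by (simp add: Suc_leI)
      ultimately have "T (u(a := u a + sum u A)) (insert a (R - A)) = 1"
        using one R S unfolding one_below_def by (metis finite_Diff finite_insert less_le_trans)
      then show ?thesis using False by simp
    qed (simp add: R(1))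
  qed
  also have "\<dots> = (\<Sum>A\<in>Pow R. (-1) ^ card A) + (\<Sum>A\<in>Pow R. if A = {} then T u S - 1 else 0)"
    unfolding sum.distrib[symmetric] by (intro sum.cong) (auto simp: algebra_simps)
  also have "\<dots> = T u S - 1"
    using sum_Pow_minus_one[of R, where ?'a = complex] R ne by simp
  finally show ?thesis .
qed

text \<open>Shifting one variable by \<open>\<tau>\<close> moves from total \<open>- \<tau>\<close>
  to total 0, where \<open>T\<close> vanishes by assumption; the step lemma then forces the value 1.
  One variable is the base case.\<close>

lemma one_below:
  assumes "vanishing_below n"
  shows "one_below n"
proof -
  have "T u S = 1" if "finite S" "1 \<le> card S" "card S < n" "sum u S = - \<tau>" "good u S" for u S
    using that
  proof (induction "card S" arbitrary: u S rule: less_induct)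
    case less
    show ?case
    proof (cases "card S = 1")
      case True
      then show ?thesis by (auto simp: card_1_singleton_iff)
    next
      case False
      then obtain a where a: "a \<in> S" using less.prems by fastforce
      have "one_below (card S)" using less unfolding one_below_def by auto
      then have "T (u(a := u a + \<tau>)) S = T u S - 1"
        using less.prems False a by (intro T_shift_tau_step[of "card S"]) auto
      moreover have "T (u(a := u a + \<tau>)) S = 0"
        using assms less.prems False a good_shift_tau[of u S a] unfolding vanishing_below_def
        by (auto simp: sum_fun_upd_add simp del: fun_upd_apply)
      ultimately show ?thesis by simp
    qed
  qed
  then show ?thesis by (auto simp: one_below_def)
qed

text \<open>From the intermediate point \<open>v\<close> with total \<open>- \<tau>\<close>, raising
  either \<open>a\<close> or \<open>b\<close> by \<open>\<tau>\<close> lowers \<open>T\<close> by 1;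
  the two results are the two sides.\<close>

lemma T_double_shift:
  assumes van: "vanishing_below (card S)" and S: "finite S" "2 \<le> card S"
    and u: "sum u S = 0" "good u S" and ab: "a \<in> S" "b \<in> S" "a \<noteq> b"
  shows "T (u(a := u a + \<tau>, b := u b - \<tau>)) S = T u S"
proof -
  define v where "v = u(b := u b - \<tau>)"
  have v: "good v S" "sum v S = - \<tau>"
    using good_shift_tau'[OF u(2) S(1), of b] sum_fun_upd_add[OF S(1), of u b "- \<tau>"] u(1) ab
    by (auto simp: v_def)
  have "T (v(a := v a + \<tau>)) S = T v S - 1" "T (v(b := v b + \<tau>)) S = T v S - 1"
    using one_below[OF van] S v ab by (auto intro!: T_shift_tau_step[of "card S"])
  moreover have "v(b := v b + \<tau>) = u" "v(a := v a + \<tau>) = u(a := u a + \<tau>, b := u b - \<tau>)"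
    using ab by (auto simp: v_def)
  ultimately show ?thesis by simp
qed

text \<open>The sign \<open>s\<close> is (-1)^k; recording only \<open>s * s = 1\<close> avoids
  integer powers.\<close>

lemma antiperiod_int: "\<exists>s. s * s = 1 \<and> (\<forall>z. h (z + of_int k * (2 * pi * \<i>)) = s * h z)"
proof (induction k rule: int_induct[where k = 0])
  case base
  show ?case by (intro exI[of _ 1]) auto
next
  case (step1 i)
  then obtain s where s: "s * s = 1" "\<And>z. h (z + of_int i * (2 * pi * \<i>)) = s * h z" by blast
  have "h (z + of_int (i + 1) * (2 * pi * \<i>)) = - s * h z" for z
    using antiperiod[of "z + of_int i * (2 * pi * \<i>)"] s(2)[of z] by (simp add: algebra_simps)
  then show ?case using s(1) by (intro exI[of _ "- s"]) auto
next
  case (step2 i)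
  then obtain s where s: "s * s = 1" "\<And>z. h (z + of_int i * (2 * pi * \<i>)) = s * h z" by blast
  have "h (z + of_int (i - 1) * (2 * pi * \<i>)) = - s * h z" for z
  proof -
    have "z + of_int i * (2 * pi * \<i>) = z + of_int (i - 1) * (2 * pi * \<i>) + 2 * pi * \<i>"
      by (simp add: algebra_simps)
    then have "s * h z = - h (z + of_int (i - 1) * (2 * pi * \<i>))"
      using antiperiod[of "z + of_int (i - 1) * (2 * pi * \<i>)"] s(2)[of z] by (simp only:)
    then show ?thesis by simp
  qed
  then show ?case using s(1) by (intro exI[of _ "- s"]) auto
qed

lemma T_shift_2pi_i:
  "finite S \<Longrightarrow> T (u(a := u a + of_int k * (2 * pi * \<i>))) S = T u S"
  using antiperiod_int[of k] F_T_shift_sign by blast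

end

section \<open>Behaviour at the poles\<close>

context theta_like
begin

lemma T_holo_good:
  assumes "finite S" "\<And>i. i \<in> S \<Longrightarrow> (\<lambda>z. U z i) holomorphic_on UNIV"
  shows "(\<lambda>z. T (U z) S) holomorphic_on {z. good (U z) S}"
  using assms by (intro T_holo) (auto simp: good_def intro: holomorphic_on_subset)

lemma T_isCont:
  assumes "finite S" "\<And>i. i \<in> S \<Longrightarrow> (\<lambda>z. U z i) holomorphic_on UNIV" "good (U z0) S"
  shows "isCont (\<lambda>z. T (U z) S) z0"
  using holomorphic_on_imp_continuous_on[OF T_holo_good[OF assms(1,2)]] open_good[OF assms(1,2)] assms(3)
  by (auto simp: continuous_on_eq_continuous_at)

lemma sum_isCont:
  assumes "\<And>i. i \<in> S \<Longrightarrow> (\<lambda>z. U z i) holomorphic_on UNIV"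
  shows "isCont (\<lambda>z. sum (U z) S) z0"
proof -
  have "(\<lambda>z. sum (U z) S) holomorphic_on UNIV" using assms by (intro holomorphic_intros)
  then show ?thesis
    using holomorphic_on_imp_continuous_on continuous_on_eq_continuous_at by blast
qed

lemma F_isCont:
  assumes "finite S" "\<And>i. i \<in> S \<Longrightarrow> (\<lambda>z. U z i) holomorphic_on UNIV" "good (U z0) S"
    "S = {} \<or> h (sum (U z0) S) \<noteq> 0"
  shows "isCont (\<lambda>z. F (U z) S) z0"
proof (cases "S = {}")
  case False
  have "isCont (\<lambda>z. T (U z) S / h (sum (U z) S)) z0"
    using assms False E_cont[where k = 0]
    by (intro continuous_divide T_isCont isCont_o2[OF sum_isCont]) (auto simp: E_0)
  then show ?thesis using assms False by (simp add: F_eq)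
qed simp

text \<open>First-order Taylor remainder of \<open>E k\<close> at the moving base point
  \<open>x z\<close> with increment \<open>z\<close>, since the derivative of \<open>E k\<close> is
  \<open>- E (Suc k)\<close>.\<close>

definition R :: "nat \<Rightarrow> (complex \<Rightarrow> complex) \<Rightarrow> complex \<Rightarrow> complex" where
  "R k x z = E k (x z + z) - E k (x z) + z * E (Suc k) (x z)"

lemma R_properties:
  assumes "x holomorphic_on UNIV"
  shows "R k x holomorphic_on UNIV" "R k x 0 = 0" "deriv (R k x) 0 = 0"
proof -
  show "R k x holomorphic_on UNIV" unfolding R_def by (intro holomorphic_intros assms)
  show "R k x 0 = 0" by (simp add: R_def)
  have x: "(x has_field_derivative deriv x 0) (at 0)"
    using assms by (intro holomorphic_derivI) auto
  note E_chain = DERIV_chain2[OF E_has_deriv]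
  \<comment> \<open>The contributions of \<open>deriv x 0\<close> cancel, so the zero at 0 is double
    even though the base point moves.\<close>
  have "(R k x has_field_derivative - E (Suc k) (x 0 + 0) * (deriv x 0 + 1) - (- E (Suc k) (x 0) * deriv x 0)
      + (1 * E (Suc k) (x 0) + (- E (Suc (Suc k)) (x 0) * deriv x 0) * 0)) (at 0)"
    unfolding R_def[abs_def]
    by (intro DERIV_add DERIV_diff DERIV_mult E_chain x DERIV_ident)
  then show "deriv (R k x) 0 = 0" by (simp add: DERIV_imp_deriv algebra_simps)
qed

lemma R_over_z:
  assumes "x holomorphic_on UNIV"
  shows "((\<lambda>z. R k x z / z) \<longlongrightarrow> 0) (at 0)"
proof -
  obtain g where g: "g holomorphic_on UNIV" "\<And>z. R k x z = z ^ 2 * g z"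
    using entire_double_zero_factor[OF R_properties[OF assms]] by blast
  then have "isCont g 0"
    using holomorphic_on_imp_continuous_on continuous_on_eq_continuous_at by blast
  then have "((\<lambda>z. z * g z) \<longlongrightarrow> 0 * g 0) (at 0)"
    by (intro tendsto_mult tendsto_ident_at) (simp add: isCont_def)
  moreover have "eventually (\<lambda>z. z * g z = R k x z / z) (at 0)"
    by (auto simp: eventually_at_filter g(2) power2_eq_square)
  ultimately show ?thesis by (auto elim!: Lim_transform_eventually)
qed

lemma E_Suc_0_even: "E (Suc 0) (- z) = E (Suc 0) z"
proof -
  have "((\<lambda>z. h (- z)) has_field_derivative (- E (Suc 0) (- z)) * (- 1)) (at z)"
    using E_has_deriv[of 0] unfolding E_0 by (intro DERIV_chain2[of h]) (auto intro!: derivative_eq_intros)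
  moreover have "((\<lambda>z. - h z) has_field_derivative - (- E (Suc 0) z)) (at z)"
    using E_has_deriv[of 0] unfolding E_0 by (intro DERIV_minus)
  ultimately show ?thesis by (simp add: odd DERIV_unique)
qed

lemma z_over_h: "((\<lambda>z. z / h z) \<longlongrightarrow> 1) (at 0)"
  using tendsto_inverse[OF h_over_z] by (simp add: inverse_eq_divide)

lemma h_eventually_nonzero_0: "eventually (\<lambda>z. h z \<noteq> 0) (at 0)"
  using tendsto_imp_eventually_ne[OF h_over_z, of 0] by (rule eventually_mono) auto

text \<open>An exact identity obtained by subtracting the expected polar part
  \<open>F u B / z\<close> from each \<open>F u (insert a B)\<close>. The remaining sums are small
  as \<open>z\<close> tends to 0, leaving the first term as the main one.\<close>

lemma T_insert_expansion:
  assumes "finite D" "a \<notin> D" "u a = z" "z \<noteq> 0" "D = {} \<or> h (sum u D) \<noteq> 0"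
  shows "T u (insert a D) = h (sum u D + z) * F u D / z
    - (\<Sum>B | B \<subset> D. E (card (D - B)) (sum u B + z) * (F u (insert a B) - F u B / z))
    - (\<Sum>B\<in>Pow D. (E (card (D - B)) (sum u B + z) - E (card (D - B)) (sum u B)
         + z * E (Suc (card (D - B))) (sum u B)) / z * F u B)"
proof -
  \<comment> \<open>The recursion defining \<open>F\<close>; for empty \<open>D\<close> it reduces
    to \<open>h 0 = 0\<close>. It removes the zeroth-order Taylor terms.\<close>
  have mid: "(\<Sum>B\<in>Pow D. E (card (D - B)) (sum u B) * F u B) = 0"
  proof (cases "D = {}")
    case False
    then have "h (sum u D) * F u D = T u D" using assms by (simp add: F_eq)
    then show ?thesis using assms(1) by (simp add: sum_Pow_proper T_def E_0)
  qed (simp add: E_0)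
  let ?r = "\<lambda>B. E (card (D - B)) (sum u B + z) - E (card (D - B)) (sum u B) + z * E (Suc (card (D - B))) (sum u B)"
  have "(\<Sum>B\<in>Pow D. ?r B / z * F u B) =
    ((\<Sum>B\<in>Pow D. E (card (D - B)) (sum u B + z) * F u B) - (\<Sum>B\<in>Pow D. E (card (D - B)) (sum u B) * F u B)) / z
    + (\<Sum>B\<in>Pow D. E (Suc (card (D - B))) (sum u B) * F u B)"
    using assms(4) by (simp add: sum_divide_distrib sum_subtractf[symmetric] sum.distrib[symmetric] field_simps)
  also have "\<dots> = (h (sum u D + z) * F u D + (\<Sum>B | B \<subset> D. E (card (D - B)) (sum u B + z) * F u B)) / z - P u D"
    using assms(1) by (simp add: mid sum_Pow_proper[of D "\<lambda>B. E (card (D - B)) (sum u B + z) * F u B"] E_0 P_def)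
  finally have r: "(\<Sum>B\<in>Pow D. ?r B / z * F u B) = \<dots>" .
  have "(\<Sum>B | B \<subset> D. E (card (D - B)) (sum u B + z) * (F u (insert a B) - F u B / z)) =
    (\<Sum>B | B \<subset> D. E (card (D - B)) (sum u B + z) * F u (insert a B)) -
    (\<Sum>B | B \<subset> D. E (card (D - B)) (sum u B + z) * F u B) / z"
    by (simp add: sum_divide_distrib sum_subtractf[symmetric] right_diff_distrib)
  moreover have "T u (insert a D) = P u D - (\<Sum>B | B \<subset> D. E (card (D - B)) (sum u B + z) * F u (insert a B))"
    using T_insert[OF assms(1,2), of u] assms(3) by (simp add: add.commute)
  ultimately show ?thesis unfolding r by (simp add: add_divide_distrib)
qed

text \<open>There is no constant term because \<open>h\<close> is odd.\<close>

lemma F_pole_part: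
  assumes "finite D" "a \<notin> D" "\<And>z. U z a = z"
    and U: "\<And>i. i \<in> D \<Longrightarrow> (\<lambda>z. U z i) holomorphic_on UNIV"
    and nz: "\<And>B. B \<subseteq> D \<Longrightarrow> B \<noteq> {} \<Longrightarrow> h (sum (U 0) B) \<noteq> 0"
  shows "((\<lambda>z. F (U z) (insert a D) - F (U z) D / z) \<longlongrightarrow> 0) (at 0)"
  using assms
proof (induction "card D" arbitrary: D rule: less_induct)
  case less
  have fin: "B \<subseteq> D \<Longrightarrow> finite B" for B using less.prems(1) by (rule rev_finite_subset)
  show ?case
  proof (cases "D = {}")
    case True
    have hol0: "(\<lambda>_. 0) holomorphic_on UNIV" by auto
    \<comment> \<open>For empty \<open>D\<close> the difference is \<open>1 / h z - 1 / z\<close>,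
      and this remainder is \<open>h z - z\<close>, an odd function with a double zero.\<close>
    have "((\<lambda>z. R 0 (\<lambda>_. 0) z / z ^ 2) \<longlongrightarrow> 0) (at 0)"
    proof (rule entire_odd_double_zero)
      fix z show "R 0 (\<lambda>_. 0) (- z) = - R 0 (\<lambda>_. 0) z"
        by (simp add: R_def E_0 E_Suc_0_0 odd)
    qed (rule R_properties[OF hol0])+
    then have "((\<lambda>z. - (R 0 (\<lambda>_. 0) z / z ^ 2) * (z / h z)) \<longlongrightarrow> - 0 * 1) (at 0)"
      by (intro tendsto_mult tendsto_minus z_over_h)
    moreover have "eventually (\<lambda>z. - (R 0 (\<lambda>_. 0) z / z ^ 2) * (z / h z) = F (U z) (insert a D) - F (U z) D / z) (at 0)"
      using h_eventually_nonzero_0 eventually_neq_at_within[of "0::complex"]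
    proof eventually_elim
      case (elim z)
      then show ?case using True less.prems(3)
        by (simp add: F_eq R_def E_0 E_Suc_0_0 field_simps power2_eq_square)
    qed
    ultimately show ?thesis by (auto elim!: Lim_transform_eventually)
  next
    case False
    \<comment> \<open>The total error in the expansion of \<open>T\<close>. Its first sum tends to 0
      by induction, its second because the Taylor remainders are quadratic.\<close>
    define Q where "Q z = (\<Sum>B | B \<subset> D. E (card (D - B)) (sum (U z) B + z) * (F (U z) (insert a B) - F (U z) B / z))
      + (\<Sum>B\<in>Pow D. R (card (D - B)) (\<lambda>z. sum (U z) B) z / z * F (U z) B)" for z
    have xc: "((\<lambda>z. sum (U z) B + z) \<longlongrightarrow> sum (U 0) B + 0) (at 0)" if "B \<subseteq> D" for B
    proof -
      have "isCont (\<lambda>z. sum (U z) B) 0" using that less.prems(4) by (intro sum_isCont) auto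
      then show ?thesis by (intro tendsto_add tendsto_ident_at) (simp add: isCont_def)
    qed
    have Ec: "((\<lambda>z. E k (sum (U z) B + z)) \<longlongrightarrow> E k (sum (U 0) B + 0)) (at 0)" if "B \<subseteq> D" for B k
      using xc[OF that] by (rule isCont_tendsto_compose[OF E_cont])
    have Fc: "((\<lambda>z. F (U z) B) \<longlongrightarrow> F (U 0) B) (at 0)" if "B \<subseteq> D" for B
    proof -
      have "isCont (\<lambda>z. F (U z) B) 0"
        using that less.prems fin by (intro F_isCont) (auto simp: good_def)
      then show ?thesis by (simp add: isCont_def)
    qed
    have "(Q \<longlongrightarrow> (\<Sum>B | B \<subset> D. E (card (D - B)) (sum (U 0) B + 0) * 0) + (\<Sum>B\<in>Pow D. 0 * F (U 0) B)) (at 0)"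
      unfolding Q_def
    proof (intro tendsto_add tendsto_sum tendsto_mult)
      fix B assume "B \<in> {B. B \<subset> D}"
      then show "((\<lambda>z. F (U z) (insert a B) - F (U z) B / z) \<longlongrightarrow> 0) (at 0)"
        using less.prems fin by (intro less.hyps) (auto intro: psubset_card_mono)
    next
      fix B assume "B \<in> Pow D"
      then show "((\<lambda>z. R (card (D - B)) (\<lambda>z. sum (U z) B) z / z) \<longlongrightarrow> 0) (at 0)"
        using less.prems by (intro R_over_z holomorphic_intros) auto
    qed (use Ec Fc in \<open>blast+\<close>)
    then have "(Q \<longlongrightarrow> 0) (at 0)" by simp
    moreover have hD: "h (sum (U 0) D) \<noteq> 0" using less.prems False by blast
    ultimately have "((\<lambda>z. - Q z / h (sum (U z) D + z)) \<longlongrightarrow> - 0 / h (sum (U 0) D + 0)) (at 0)"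
      using Ec[of D 0] by (intro tendsto_divide tendsto_minus) (auto simp: E_0)
    moreover have "eventually (\<lambda>z. - Q z / h (sum (U z) D + z) = F (U z) (insert a D) - F (U z) D / z) (at 0)"
    proof -
      have "((\<lambda>z. E 0 (sum (U z) D)) \<longlongrightarrow> E 0 (sum (U 0) D)) (at 0)"
        using sum_isCont[of D U 0] less.prems(4)
        by (intro isCont_tendsto_compose[OF E_cont]) (auto simp: isCont_def)
      then have "eventually (\<lambda>z. h (sum (U z) D) \<noteq> 0) (at 0)"
        using hD by (auto simp: E_0 dest: tendsto_imp_eventually_ne)
      moreover have "eventually (\<lambda>z. h (sum (U z) D + z) \<noteq> 0) (at 0)"
        using tendsto_imp_eventually_ne[OF Ec[of D 0], of 0] hD by (simp add: E_0)
      moreover have "eventually (\<lambda>z::complex. z \<noteq> 0) (at 0)" by (rule eventually_neq_at_within)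
      ultimately show ?thesis
      proof eventually_elim
        case (elim z)
        have "T (U z) (insert a D) = h (sum (U z) D + z) * F (U z) D / z - Q z"
          using elim less.prems by (subst T_insert_expansion[where z = z]) (auto simp: Q_def R_def)
        moreover have "sum (U z) (insert a D) = sum (U z) D + z"
          using less.prems by simp
        ultimately show ?case using elim less.prems(1) by (simp add: F_eq field_simps)
      qed
    qed
    ultimately show ?thesis by (auto elim!: Lim_transform_eventually)
  qed
qed

text \<open>The main term of the expansion disappears because the total is zero and
  \<open>h 0 = 0\<close>. The remainder term for \<open>B = S\<close> needs separate care, since
  \<open>F (U z) S\<close> may have a pole at 0.\<close>

lemma T_tendsto_0:
  assumes "finite S" "a \<notin> S" "\<And>z. U z a = z"
    and U: "\<And>i. i \<in> S \<Longrightarrow> (\<lambda>z. U z i) holomorphic_on UNIV"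
    and S: "\<And>z. sum (U z) S = - z"
    and nz: "good (U 0) S"
  shows "((\<lambda>z. T (U z) (insert a S)) \<longlongrightarrow> 0) (at 0)"
proof -
  have fin: "B \<subseteq> S \<Longrightarrow> finite B" for B using assms(1) by (rule rev_finite_subset)
  have "S \<noteq> {}" using S[of 1] by auto
  define Q where "Q z = (\<Sum>B | B \<subset> S. E (card (S - B)) (sum (U z) B + z) * (F (U z) (insert a B) - F (U z) B / z))
    + (\<Sum>B | B \<subset> S. R (card (S - B)) (\<lambda>z. sum (U z) B) z / z * F (U z) B)" for z
  have Ec: "((\<lambda>z. E k (sum (U z) B + z)) \<longlongrightarrow> E k (sum (U 0) B + 0)) (at 0)" if "B \<subseteq> S" for B k
  proof -
    have "isCont (\<lambda>z. sum (U z) B) 0" using that U by (intro sum_isCont) auto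
    then show ?thesis
      by (intro isCont_tendsto_compose[OF E_cont] tendsto_add tendsto_ident_at) (simp add: isCont_def)
  qed
  have nz': "h (sum (U 0) C) \<noteq> 0" if "B \<subset> S" "C \<subseteq> B" "C \<noteq> {}" for B C
    using goodD[OF nz] that by blast
  have Fc: "((\<lambda>z. F (U z) B) \<longlongrightarrow> F (U 0) B) (at 0)" if "B \<subset> S" for B
  proof -
    have "isCont (\<lambda>z. F (U z) B) 0"
      using that U fin nz' by (intro F_isCont) (auto simp: good_def)
    then show ?thesis by (simp add: isCont_def)
  qed
  have "(Q \<longlongrightarrow> (\<Sum>B | B \<subset> S. E (card (S - B)) (sum (U 0) B + 0) * 0) + (\<Sum>B | B \<subset> S. 0 * F (U 0) B)) (at 0)"
    unfolding Q_def
  proof (intro tendsto_add tendsto_sum tendsto_mult)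
    fix B assume B: "B \<in> {B. B \<subset> S}"
    show "((\<lambda>z. F (U z) (insert a B) - F (U z) B / z) \<longlongrightarrow> 0) (at 0)"
      using B assms(2,3) U fin nz' by (intro F_pole_part) auto
    show "((\<lambda>z. R (card (S - B)) (\<lambda>z. sum (U z) B) z / z) \<longlongrightarrow> 0) (at 0)"
      using B U by (intro R_over_z holomorphic_intros) auto
  qed (use Ec Fc in \<open>blast+\<close>)
  then have Q: "(Q \<longlongrightarrow> 0) (at 0)" by simp
  have hol: "(\<lambda>z. - z) holomorphic_on UNIV" by (intro holomorphic_intros)
  \<comment> \<open>This remainder equals \<open>h z + z * E 1 z\<close>, which is odd because
    \<open>E 1\<close> is even. Its vanishing beyond second order compensates the pole of
    \<open>F (U z) S\<close>.\<close>
  have "((\<lambda>z. R 0 (\<lambda>z. - z) z / z ^ 2) \<longlongrightarrow> 0) (at 0)"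
  proof (rule entire_odd_double_zero)
    fix z show "R 0 (\<lambda>z. - z) (- z) = - R 0 (\<lambda>z. - z) z"
      by (simp add: R_def E_0 odd E_Suc_0_even)
  qed (rule R_properties[OF hol])+
  moreover have "((\<lambda>z. T (U z) S) \<longlongrightarrow> T (U 0) S) (at 0)"
    using T_isCont[OF assms(1) U nz] by (simp add: isCont_def)
  ultimately have "((\<lambda>z. R 0 (\<lambda>z. - z) z / z ^ 2 * (z / h z) * T (U z) S - Q z) \<longlongrightarrow> 0 * 1 * T (U 0) S - 0) (at 0)"
    using Q z_over_h by (intro tendsto_diff tendsto_mult)
  moreover have "eventually (\<lambda>z. R 0 (\<lambda>z. - z) z / z ^ 2 * (z / h z) * T (U z) S - Q z = T (U z) (insert a S)) (at 0)"
    using h_eventually_nonzero_0 eventually_neq_at_within[of "0::complex"]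
  proof eventually_elim
    case (elim z)
    have "T (U z) (insert a S) = - (R 0 (\<lambda>z. - z) z / z * F (U z) S) - Q z"
      using elim assms(1-3) by (subst T_insert_expansion[where z = z])
        (auto simp: Q_def R_def S odd sum_Pow_proper E_0)
    also have "F (U z) S = - T (U z) S / h z"
      using assms(1) \<open>S \<noteq> {}\<close> by (simp add: F_eq S odd)
    finally show ?case using elim by (simp add: power2_eq_square)
  qed
  ultimately show ?thesis by (auto elim!: Lim_transform_eventually)
qed

lemma tendsto_imp_bigo_1: "(f \<longlongrightarrow> l) G \<Longrightarrow> f \<in> O[G](\<lambda>_. 1 :: complex)" for f :: "complex \<Rightarrow> complex"
  by (rule bigoI_tendsto[of _ _ l]) auto

text \<open>Whenever the denominator of \<open>F (U z) B\<close> vanishes at \<open>z0\<close>, it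
  has a simple zero there, its argument being plus or minus \<open>z - z0\<close>; the zero of the
  numerator \<open>T (U z) B\<close> cancels it. Boundedness then spreads through the
  recursion.\<close>

lemma T_bigo_1:
  assumes "finite S" and U: "\<And>i. i \<in> S \<Longrightarrow> (\<lambda>z. U z i) holomorphic_on UNIV"
    and pole: "\<And>B. B \<subset> S \<Longrightarrow> B \<noteq> {} \<Longrightarrow> h (sum (U z0) B) = 0 \<Longrightarrow>
       good (U z0) B \<and> T (U z0) B = 0 \<and> (\<exists>s. s * s = 1 \<and> (\<forall>z. sum (U z) B = s * (z - z0)))"
  shows "(\<lambda>z. T (U z) S) \<in> O[at z0](\<lambda>_. 1)"
proof -
  have fin: "B \<subset> S \<Longrightarrow> finite B" for B using assms(1) by (auto intro: finite_subset)
  have Ec: "((\<lambda>z. E k (sum (U z) B)) \<longlongrightarrow> E k (sum (U z0) B)) (at z0)" if "B \<subset> S" for B k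
    using sum_isCont[of B U z0] that U
    by (intro isCont_tendsto_compose[OF E_cont]) (auto simp: isCont_def)
  have T: "(\<lambda>z. T (U z) C) \<in> O[at z0](\<lambda>_. 1)"
    if "C \<subseteq> S" "\<And>B. B \<subset> C \<Longrightarrow> (\<lambda>z. F (U z) B) \<in> O[at z0](\<lambda>_. 1)" for C
  proof -
    have "(\<lambda>z. \<Sum>B | B \<subset> C. E (card (C - B)) (sum (U z) B) * F (U z) B) \<in> O[at z0](\<lambda>_. 1)"
      using that by (intro big_sum_in_bigo landau_o.big.mult_in_1 tendsto_imp_bigo_1[OF Ec]) auto
    then show ?thesis unfolding T_def by simp
  qed
  have "(\<lambda>z. F (U z) B) \<in> O[at z0](\<lambda>_. 1)" if "B \<subset> S" for B
    using that
  proof (induction "card B" arbitrary: B rule: less_induct)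
    case (less B)
    have finB: "finite B" using fin less.prems by blast
    show ?case
    proof (cases "B = {}")
      case False
      note nonempty = this
      show ?thesis
      proof (cases "h (sum (U z0) B) = 0")
        case False
        have "(\<lambda>z. T (U z) B) \<in> O[at z0](\<lambda>_. 1)"
          using less finB by (intro T less.hyps) (auto intro: psubset_card_mono)
        moreover have "(\<lambda>z. inverse (h (sum (U z) B))) \<in> O[at z0](\<lambda>_. 1)"
          using Ec[OF less.prems, of 0] False
          by (intro tendsto_imp_bigo_1[OF tendsto_inverse]) (auto simp: E_0)
        ultimately have "(\<lambda>z. T (U z) B * inverse (h (sum (U z) B))) \<in> O[at z0](\<lambda>_. 1)"
          by (rule landau_o.big.mult_in_1)
        then show ?thesis using finB nonempty by (simp add: F_eq divide_inverse)
      next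
        case True
        then obtain s where s: "s * s = 1" "\<And>z. sum (U z) B = s * (z - z0)"
          and g: "good (U z0) B" and T0: "T (U z0) B = 0"
          using pole[OF less.prems nonempty] by blast
        from s(1) have "s = 1 \<or> s = - 1" by (simp add: square_eq_1_iff)
        then have hs: "h (s * w) = s * h w" for w using odd[of w] by auto
        \<comment> \<open>\<open>F (U z) B\<close> is the product of the difference quotient of
          \<open>t\<close>, the factor \<open>(z - z0) / h (z - z0)\<close> tending to 1, and a
          sign.\<close>
        define t where "t = (\<lambda>z. T (U z) B)"
        have "t holomorphic_on {z. good (U z) B}" unfolding t_def
          using finB U less.prems by (intro T_holo_good) auto
        moreover have "open {z. good (U z) B}" using finB U less.prems by (intro open_good) auto
        ultimately have "(t has_field_derivative deriv t z0) (at z0)"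
          using g by (intro holomorphic_derivI) auto
        then have 1: "((\<lambda>z. t z / (z - z0)) \<longlongrightarrow> deriv t z0) (at z0)"
          using T0 by (simp add: t_def has_field_derivative_iff)
        have "filterlim (\<lambda>z. z - z0) (at 0) (at z0)"
          by (rule filterlim_atI) (auto intro!: tendsto_eq_intros simp: eventually_at_filter)
        then have 2: "((\<lambda>z. (z - z0) / h (z - z0)) \<longlongrightarrow> 1) (at z0)"
          using filterlim_compose[OF z_over_h] by blast
        have "((\<lambda>z. t z / (z - z0) * ((z - z0) / h (z - z0)) * inverse s) \<longlongrightarrow> deriv t z0 * 1 * inverse s) (at z0)"
          by (intro tendsto_mult 1 2 tendsto_const)
        moreover have "eventually (\<lambda>z. t z / (z - z0) * ((z - z0) / h (z - z0)) * inverse s = F (U z) B) (at z0)"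
          using eventually_neq_at_within[of z0]
        proof eventually_elim
          case (elim z)
          then show ?case using finB nonempty by (simp add: F_eq t_def s(2) hs divide_inverse)
        qed
        ultimately have "((\<lambda>z. F (U z) B) \<longlongrightarrow> deriv t z0 * 1 * inverse s) (at z0)"
          by (rule Lim_transform_eventually)
        then show ?thesis by (rule tendsto_imp_bigo_1)
      qed
    qed simp
  qed
  then show ?thesis by (intro T) auto
qed

end

section \<open>Vanishing on the hyperplane\<close>

lemma entire_extension:
  fixes f :: "complex \<Rightarrow> complex"
  assumes holo: "f holomorphic_on - X" and iso: "\<And>p. eventually (\<lambda>z. z \<notin> X) (at p)"
    and bnd: "\<And>p. f \<in> O[at p](\<lambda>_. 1)"
  obtains g where "g holomorphic_on UNIV" "\<And>p. (f \<longlongrightarrow> g p) (at p)" "\<And>z. z \<notin> X \<Longrightarrow> g z = f z"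
proof -
  have ex: "\<exists>r k. r > 0 \<and> k holomorphic_on ball p r \<and> (\<forall>z\<in>ball p r - {p}. z \<notin> X \<and> k z = f z)" for p
  proof -
    obtain r where r: "r > 0" "\<And>z. z \<in> ball p r - {p} \<Longrightarrow> z \<notin> X"
      using iso[of p] unfolding eventually_at by (auto simp: dist_commute)
    have "f holomorphic_on ball p r - {p}"
      using r(2) by (intro holomorphic_on_subset[OF holo]) auto
    moreover have "p \<in> interior (ball p r)" using r(1) by simp
    ultimately have "\<exists>k. k holomorphic_on ball p r \<and> (\<forall>z\<in>ball p r - {p}. k z = f z)"
      using bnd by (rule holomorphic_on_extend)
    with r show ?thesis by blast
  qed
  then obtain r k where rk: "\<And>p. r p > 0" "\<And>p. k p holomorphic_on ball p (r p)"
    "\<And>p z. z \<in> ball p (r p) - {p} \<Longrightarrow> z \<notin> X \<and> k p z = f z" by metis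
  \<comment> \<open>The local extensions are glued by taking each at its centre; uniqueness of
    limits makes them agree with \<open>f\<close> off \<open>X\<close>.\<close>
  define g where "g p = k p p" for p
  have lim: "(f \<longlongrightarrow> g p) (at p)" for p
  proof -
    have "isCont (k p) p"
      using rk(1,2)[of p] holomorphic_on_imp_continuous_on continuous_on_eq_continuous_at
      by (metis centre_in_ball open_ball)
    then have "(k p \<longlongrightarrow> g p) (at p)" by (simp add: isCont_def g_def)
    then show ?thesis
      by (rule Lim_transform_within_open[of _ _ _ _ "ball p (r p)"]) (use rk in auto)
  qed
  have gf: "g z = f z" if "z \<notin> X" for z
  proof -
    have "eventually (\<lambda>w. w \<in> - X) (nhds z)"
      using iso[of z] that by (auto simp: eventually_at_filter elim: eventually_mono)
    then obtain A where A: "open A" "z \<in> A" "A \<subseteq> - X" by (auto simp: eventually_nhds)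
    then have "isCont f z"
      using holomorphic_on_imp_continuous_on[OF holomorphic_on_subset[OF holo A(3)]]
      by (simp add: continuous_on_eq_continuous_at)
    then show ?thesis using LIM_unique[OF lim[of z]] by (simp add: isCont_def)
  qed
  have "g field_differentiable at p" for p
  proof -
    have "g holomorphic_on ball p (r p)"
    proof (rule holomorphic_transform[OF rk(2)])
      fix z assume "z \<in> ball p (r p)"
      then show "k p z = g z" using rk(3)[of z p] gf[of z] by (cases "z = p") (auto simp: g_def)
    qed
    then show ?thesis using rk(1) by (intro holomorphic_on_imp_differentiable_at[of _ "ball p (r p)"]) auto
  qed
  then have "g holomorphic_on UNIV" by (simp add: holomorphic_on_def)
  with lim gf that show thesis by blast
qed

lemma entire_doubly_periodic_constant:
  fixes g :: "complex \<Rightarrow> complex"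
  assumes g: "g holomorphic_on UNIV" and "Re \<tau> \<noteq> 0"
    and p1: "\<And>z. g (z + \<tau>) = g z" and p2: "\<And>z. g (z + 2 * pi * \<i>) = g z"
  shows "g z = g w"
proof -
  have int_period: "g (z + of_int k * p) = g z" if "\<And>z. g (z + p) = g z" for p z k
  proof (induction k rule: int_induct[where k = 0])
    case (step1 i)
    then show ?case using that[of "z + of_int i * p"] by (simp add: algebra_simps)
  next
    case (step2 i)
    then show ?case using that[of "z + of_int (i - 1) * p"] by (simp add: algebra_simps)
  qed simp
  define M where "M = norm \<tau> + 2 * pi"
  have "g z \<in> g ` cball 0 M" for z
  proof -
    \<comment> \<open>Real coordinates of \<open>z\<close> in the basis formed by
      \<open>\<tau>\<close> and 2 pi i; their fractional parts give a representative in a bounded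
      parallelogram.\<close>
    define a where "a = Re z / Re \<tau>"
    define b where "b = (Im z - a * Im \<tau>) / (2 * pi)"
    define y where "y = of_real (frac a) * \<tau> + of_real (frac b) * (2 * pi * \<i>)"
    have "z = of_real a * \<tau> + of_real b * (2 * pi * \<i>)"
      using assms(2) by (simp add: complex_eq_iff a_def b_def)
    also have "\<dots> = y + of_int \<lfloor>a\<rfloor> * \<tau> + of_int \<lfloor>b\<rfloor> * (2 * pi * \<i>)"
      by (simp add: y_def frac_def algebra_simps)
    finally have "g z = g y" using int_period[OF p1] int_period[OF p2] by simp
    moreover have "norm y \<le> norm (of_real (frac a) * \<tau>) + norm (of_real (frac b) * (2 * pi * \<i>))"
      unfolding y_def by (rule norm_triangle_ineq)
    moreover have "norm (of_real (frac a) * \<tau>) \<le> norm \<tau>"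
      by (simp add: norm_mult mult_left_le_one_le frac_lt_1 less_imp_le)
    moreover have "norm (of_real (frac b) * (2 * pi * \<i>)) \<le> 2 * pi"
      by (simp add: norm_mult mult_left_le_one_le frac_lt_1 less_imp_le)
    ultimately show ?thesis by (auto simp: M_def)
  qed
  then have "range g \<subseteq> g ` cball 0 M" by blast
  moreover have "compact (g ` cball 0 M)"
    by (intro compact_continuous_image holomorphic_on_imp_continuous_on[OF holomorphic_on_subset[OF g]]) auto
  ultimately have "bounded (range g)" using bounded_subset compact_imp_bounded by blast
  then have "g constant_on UNIV" using Liouville_theorem g by blast
  then show ?thesis by (auto simp: constant_on_def)
qed

lemma bigo_1_shift:
  fixes f :: "complex \<Rightarrow> complex"
  assumes "eventually (\<lambda>z. f (z + \<omega>) = f z) (at p)"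
  shows "f \<in> O[at (p + \<omega>)](\<lambda>_. 1) \<longleftrightarrow> f \<in> O[at p](\<lambda>_. 1)"
proof -
  have "at (p + \<omega>) = filtermap (\<lambda>z. z + \<omega>) (at p)"
    using filtermap_at_shift[of "- \<omega>" p] by simp
  then have "f \<in> O[at (p + \<omega>)](\<lambda>_. 1) \<longleftrightarrow> (\<lambda>z. f (z + \<omega>)) \<in> O[at p](\<lambda>_. 1)"
    by (simp add: landau_o.big.in_filtermap_iff)
  also have "\<dots> \<longleftrightarrow> f \<in> O[at p](\<lambda>_. 1)"
    using assms by (rule landau_o.big.in_cong)
  finally show ?thesis .
qed

lemma bigo_1_int_shift:
  fixes f :: "complex \<Rightarrow> complex"
  assumes "\<And>p. eventually (\<lambda>z. f (z + \<omega>) = f z) (at p)"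
  shows "f \<in> O[at (p + of_int k * \<omega>)](\<lambda>_. 1) \<longleftrightarrow> f \<in> O[at p](\<lambda>_. 1)"
proof (induction k rule: int_induct[where k = 0])
  case (step1 i)
  then show ?case using bigo_1_shift[OF assms, of "p + of_int i * \<omega>"] by (simp add: algebra_simps)
next
  case (step2 i)
  then show ?case using bigo_1_shift[OF assms, of "p + of_int (i - 1) * \<omega>"] by (simp add: algebra_simps)
qed simp

context theta_like
begin

text \<open>\<open>h\<close> is not identically zero because \<open>h z / z\<close> tends to 1 at 0,
  so its zeros along a nonconstant affine map are isolated.\<close>

lemma h_affine_eventually_nonzero:
  assumes "m \<noteq> 0"
  shows "eventually (\<lambda>z. h (y + z * m) \<noteq> 0) (at p)"
proof -
  have "\<exists>w. h w \<noteq> 0"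
    using eventually_happens[OF h_eventually_nonzero_0] by auto
  then obtain w where w: "h w \<noteq> 0" by blast
  have "eventually (\<lambda>z. h (y + z * m) \<noteq> 0 \<and> z \<in> UNIV) (at p)"
    by (rule non_zero_neighbour_alt[where \<beta> = "(w - y) / m"])
       (use w assms in \<open>auto intro!: holomorphic_intros\<close>)
  then show ?thesis by simp
qed

lemma h_minus_eq_0_iff: "h (- z) = 0 \<longleftrightarrow> h z = 0"
  by (simp add: odd)

end

text \<open>Genericity keeps the possible poles attached to different subsets apart modulo the zeros
  of \<open>h\<close>; with \<open>C = {}\<close> it also makes the sums over nonempty subsets of
  \<open>S\<close> harmless. Here \<open>S\<close> holds the fixed variables, while \<open>a\<close>
  and \<open>b\<close> move.\<close>

locale generic_hyperplane = theta_like +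
  fixes u :: "nat \<Rightarrow> complex" and a b :: nat and S :: "nat set"
  assumes fin: "finite S" and ab: "a \<noteq> b" "a \<notin> S" "b \<notin> S"
    and generic: "\<And>B C. B \<subseteq> S \<Longrightarrow> C \<subseteq> S \<Longrightarrow> B \<noteq> C \<Longrightarrow> h (sum u B - sum u C) \<noteq> 0"
    and vanishing: "vanishing_below (card (insert a (insert b S)))"
begin

abbreviation "Sab \<equiv> insert a (insert b S)"

definition U :: "complex \<Rightarrow> nat \<Rightarrow> complex" where
  "U z = u(a := z, b := - sum u S - z)"

text \<open>The possible poles along the line. Sets containing \<open>b\<close> but not
  \<open>a\<close> add none, since their sums are, up to sign, those of their complements.\<close>

definition X :: "complex set" where
  "X = {z. \<exists>B\<subseteq>S. h (z + sum u B) = 0}"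

lemma U_holo: "(\<lambda>z. U z i) holomorphic_on A"
  unfolding U_def fun_upd_def
  by (cases "i = b"; cases "i = a") (simp_all add: holomorphic_intros)

lemma finB: "B \<subseteq> S \<Longrightarrow> finite B"
  using fin by (rule rev_finite_subset)

lemma sum_U_none: "B \<subseteq> S \<Longrightarrow> sum (U z) B = sum u B"
  using ab by (intro sum.cong) (auto simp: U_def)

lemma sum_U_a: "B \<subseteq> S \<Longrightarrow> sum (U z) (insert a B) = z + sum u B"
  using ab finB[of B] sum_U_none[of B z] by (subst sum.insert) (auto simp: U_def)

lemma sum_compl: "B \<subseteq> S \<Longrightarrow> sum u S = sum u B + sum u (S - B)"
  using fin by (simp add: sum.subset_diff add.commute)

text \<open>The total over \<open>Sab\<close> is 0, so this is minus the sum over the complementary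
  set.\<close>

lemma sum_U_b: "B \<subseteq> S \<Longrightarrow> sum (U z) (insert b B) = - (z + sum u (S - B))"
  using ab finB[of B] sum_U_none[of B z] sum_compl[of B] by (subst sum.insert) (auto simp: U_def)

lemma sum_U_ab: "B \<subseteq> S \<Longrightarrow> sum (U z) (insert a (insert b B)) = - sum u (S - B)"
  using ab finB[of B] sum_U_b[of B z] by (subst sum.insert) (auto simp: U_def)

lemma generic_0: "B \<subseteq> S \<Longrightarrow> B \<noteq> {} \<Longrightarrow> h (sum u B) \<noteq> 0"
  using generic[of B "{}"] by simp

lemma subset_cases:
  assumes "C \<subseteq> Sab"
  obtains B where "B \<subseteq> S" "C = B" | B where "B \<subseteq> S" "C = insert a B"
    | B where "B \<subseteq> S" "C = insert b B" | B where "B \<subseteq> S" "C = insert a (insert b B)"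
proof -
  have "C \<inter> S \<subseteq> S" by blast
  moreover have "C = C \<inter> S \<or> C = insert a (C \<inter> S) \<or> C = insert b (C \<inter> S) \<or> C = insert a (insert b (C \<inter> S))"
    using assms by auto
  ultimately show thesis using that by metis
qed

lemma good_U: "z \<notin> X \<Longrightarrow> good (U z) Sab"
  unfolding good_def
proof (intro allI impI)
  fix C assume z: "z \<notin> X" and C: "C \<subset> Sab" "C \<noteq> {}"
  from C(1) have "C \<subseteq> Sab" by blast
  then show "h (sum (U z) C) \<noteq> 0"
  proof (cases rule: subset_cases)
    case (1 B)
    then show ?thesis using C generic_0 by (simp add: sum_U_none)
  next
    case (2 B)
    then show ?thesis using z by (auto simp: sum_U_a X_def)
  next
    case (3 B)
    then show ?thesis using z by (auto simp: sum_U_b X_def h_minus_eq_0_iff simp del: minus_add_distrib)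
  next
    case (4 B)
    then have "S - B \<noteq> {}" using C by auto
    then show ?thesis using 4 generic_0[of "S - B"] by (auto simp: sum_U_ab h_minus_eq_0_iff)
  qed
qed

lemma sum_U_Sab: "sum (U z) Sab = 0"
  using sum_U_ab[of S z] by simp

lemma card_Sab: "card Sab = Suc (Suc (card S))"
  using fin ab by simp

lemma T_U_tendsto_0: "((\<lambda>z. T (U z) Sab) \<longlongrightarrow> 0) (at 0)"
proof (rule T_tendsto_0)
  show "finite (insert b S)" "a \<notin> insert b S" using fin ab by auto
  show "U z a = z" for z using ab by (simp add: U_def)
  show "(\<lambda>z. U z i) holomorphic_on UNIV" for i by (rule U_holo)
  show "sum (U z) (insert b S) = - z" for z by (simp add: sum_U_b)
  show "good (U 0) (insert b S)"
    unfolding good_def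
  proof (intro allI impI)
    fix C assume C: "C \<subset> insert b S" "C \<noteq> {}"
    show "h (sum (U 0) C) \<noteq> 0"
    proof (cases "b \<in> C")
      case True
      define B where "B = C - {b}"
      have "C = insert b B" "B \<subseteq> S" "S - B \<noteq> {}" using True C ab by (auto simp: B_def)
      then show ?thesis using generic_0[of "S - B"] by (simp add: sum_U_b h_minus_eq_0_iff)
    next
      case False
      then have "C \<subseteq> S" using C by auto
      then show ?thesis using C generic_0 by (simp add: sum_U_none)
    qed
  qed
qed

text \<open>By genericity only \<open>insert a B\<close> and its complement
  \<open>insert b (S - B)\<close> have vanishing denominators at \<open>- sum u B\<close>. Both are
  proper and have at least two elements, so the induction hypothesis makes their numerators
  vanish.\<close>

lemma T_U_bigo_interior:
  assumes B: "B \<subseteq> S" "B \<noteq> {}" "B \<noteq> S"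
  shows "(\<lambda>z. T (U z) Sab) \<in> O[at (- sum u B)](\<lambda>_. 1)"
proof (rule T_bigo_1)
  define z0 where "z0 = - sum u B"
  have *: "h (z0 + sum u D) = 0 \<Longrightarrow> D = B" if "D \<subseteq> S" for D
    using generic[of D B] that B by (auto simp: z0_def algebra_simps)
  show "finite Sab" using fin by simp
  show "(\<lambda>z. U z i) holomorphic_on UNIV" for i by (rule U_holo)
  fix C assume C: "C \<subset> Sab" "C \<noteq> {}" and "h (sum (U (- sum u B)) C) = 0"
  then have h0: "h (sum (U z0) C) = 0" by (simp add: z0_def)
  from C(1) have "C \<subseteq> Sab" by blast
  then have "good (U z0) C \<and> 2 \<le> card C \<and> sum (U z0) C = 0 \<and> (\<exists>s. s * s = 1 \<and> (\<forall>z. sum (U z) C = s * (z - z0)))"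
  proof (cases rule: subset_cases)
    case (1 D)
    then show ?thesis using h0 C generic_0 by (simp add: sum_U_none)
  next
    case (2 D)
    then have D: "C = insert a B" using h0 * by (simp add: sum_U_a)
    have "good (U z0) C" unfolding good_def
    proof (intro allI impI)
      fix A assume A: "A \<subset> C" "A \<noteq> {}"
      show "h (sum (U z0) A) \<noteq> 0"
      proof (cases "a \<in> A")
        case True
        define A' where "A' = A - {a}"
        have "A = insert a A'" "A' \<subset> B" using True A D ab by (auto simp: A'_def)
        then show ?thesis using B *[of A'] by (auto simp: sum_U_a)
      next
        case False
        then have "A \<subseteq> S" using A D B by auto
        then show ?thesis using A generic_0 by (simp add: sum_U_none)
      qed
    qed
    moreover have "2 \<le> card C"
      using D B ab finB[of B] by (auto simp: card_insert_if card_gt_0_iff Suc_le_eq)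
    moreover have "sum (U z) C = 1 * (z - z0)" for z using D B by (simp add: sum_U_a z0_def)
    ultimately show ?thesis by (metis diff_self mult_1 mult_zero_right)
  next
    case (3 D)
    then have "h (z0 + sum u (S - D)) = 0" using h0 by (simp add: sum_U_b h_minus_eq_0_iff del: minus_add_distrib)
    then have SD: "S - D = B" using *[of "S - D"] by blast
    then have D: "D = S - B" "C = insert b (S - B)" using 3 by auto
    have "good (U z0) C" unfolding good_def
    proof (intro allI impI)
      fix A assume A: "A \<subset> C" "A \<noteq> {}"
      show "h (sum (U z0) A) \<noteq> 0"
      proof (cases "b \<in> A")
        case True
        define A' where "A' = A - {b}"
        have A': "A = insert b A'" "A' \<subseteq> S" "S - A' \<noteq> B" using True A D ab B by (auto simp: A'_def)
        then show ?thesis using *[of "S - A'"] by (auto simp: sum_U_b h_minus_eq_0_iff simp del: minus_add_distrib)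
      next
        case False
        then have "A \<subseteq> S" using A D B by auto
        then show ?thesis using A generic_0 by (simp add: sum_U_none)
      qed
    qed
    moreover have "2 \<le> card C"
      using D B ab fin by (auto simp: card_insert_if card_gt_0_iff Suc_le_eq)
    moreover have "sum (U z) C = - 1 * (z - z0)" for z using D SD 3 by (simp add: sum_U_b z0_def)
    ultimately show ?thesis by (intro conjI exI[of _ "- 1"]) auto
  next
    case (4 D)
    then have "S - D \<noteq> {}" using C by auto
    then show ?thesis using 4 h0 generic_0[of "S - D"] by (auto simp: sum_U_ab h_minus_eq_0_iff)
  qed
  moreover have "finite C" using C(1) fin by (auto intro: finite_subset)
  moreover have "card C < card Sab" using C(1) fin by (intro psubset_card_mono) auto
  ultimately show "good (U (- sum u B)) C \<and> T (U (- sum u B)) C = 0 \<and>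
      (\<exists>s. s * s = 1 \<and> (\<forall>z. sum (U z) C = s * (z - - sum u B)))"
    using vanishing unfolding vanishing_below_def z0_def by blast
qed

lemma T_U_shift_tau: "z \<notin> X \<Longrightarrow> T (U (z + \<tau>)) Sab = T (U z) Sab"
proof -
  assume z: "z \<notin> X"
  have "U (z + \<tau>) = (U z)(a := U z a + \<tau>, b := U z b - \<tau>)"
    using ab by (auto simp: U_def)
  then show ?thesis
    using T_double_shift[of Sab "U z" a b] vanishing fin ab good_U[OF z] sum_U_Sab card_Sab by simp
qed

lemma T_U_shift_2pi_i: "T (U (z + 2 * pi * \<i>)) Sab = T (U z) Sab"
proof -
  define v where "v = (U z)(a := U z a + of_int 1 * (2 * pi * \<i>))"
  have "U (z + 2 * pi * \<i>) = v(b := v b + of_int (- 1) * (2 * pi * \<i>))"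
    using ab by (auto simp: U_def v_def)
  then have "T (U (z + 2 * pi * \<i>)) Sab = T v Sab"
    using fin T_shift_2pi_i[of Sab v b "- 1"] by (simp del: of_int_minus)
  also have "\<dots> = T (U z) Sab" unfolding v_def
    using fin by (intro T_shift_2pi_i) auto
  finally show ?thesis .
qed

lemma X_isolated: "eventually (\<lambda>z. z \<notin> X) (at p)"
proof -
  have "eventually (\<lambda>z. \<forall>B\<in>Pow S. h (sum u B + z * 1) \<noteq> 0) (at p)"
    using fin by (intro eventually_ball_finite ballI h_affine_eventually_nonzero) auto
  then show ?thesis by (rule eventually_mono) (auto simp: X_def add.commute)
qed

text \<open>Exchanging \<open>a\<close> and \<open>b\<close> amounts to replacing \<open>z\<close>
  by \<open>- sum u S - z\<close>, which carries this point to 0.\<close>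

lemma T_U_tendsto_0': "((\<lambda>z. T (U z) Sab) \<longlongrightarrow> 0) (at (- sum u S))"
proof -
  interpret swap: generic_hyperplane h \<tau> c u b a S
    using fin ab generic vanishing by unfold_locales (auto simp: insert_commute)
  have "swap.U z = U (- sum u S - z)" for z
    using ab by (auto simp: U_def swap.U_def)
  then have "((\<lambda>z. T (U (- sum u S - z)) Sab) \<longlongrightarrow> 0) (at 0)"
    using swap.T_U_tendsto_0 by (simp add: insert_commute)
  moreover have "filterlim (\<lambda>z. - sum u S - z) (at 0) (at (- sum u S))"
  proof (rule filterlim_atI)
    show "eventually (\<lambda>z. - sum u S - z \<noteq> 0) (at (- sum u S))"
      using eventually_neq_at_within[of "- sum u S"] by (rule eventually_mono) auto
  qed (auto intro!: tendsto_eq_intros)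
  ultimately show ?thesis using filterlim_compose by fastforce
qed

lemma T_U_bigo_base: "B \<subseteq> S \<Longrightarrow> (\<lambda>z. T (U z) Sab) \<in> O[at (- sum u B)](\<lambda>_. 1)"
proof -
  assume "B \<subseteq> S"
  moreover have "- sum u {} = 0" by simp
  ultimately show ?thesis
    using tendsto_imp_bigo_1[OF T_U_tendsto_0] tendsto_imp_bigo_1[OF T_U_tendsto_0'] T_U_bigo_interior[of B]
    by metis
qed

text \<open>Each point of \<open>X\<close> is a lattice translate of some \<open>- sum u B\<close>,
  and both periods preserve local boundedness.\<close>

lemma T_U_bigo: "(\<lambda>z. T (U z) Sab) \<in> O[at p](\<lambda>_. 1)"
proof (cases "p \<in> X")
  case True
  then obtain B k l where B: "B \<subseteq> S" and kl: "p + sum u B = of_int k * \<tau> + of_int l * (2 * pi * \<i>)"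
    unfolding X_def using zeros by blast
  have "eventually (\<lambda>z. T (U (z + \<tau>)) Sab = T (U z) Sab) (at q)" for q
    using X_isolated by (rule eventually_mono) (rule T_U_shift_tau)
  then have 1: "(\<lambda>z. T (U z) Sab) \<in> O[at (q + of_int k * \<tau>)](\<lambda>_. 1) \<longleftrightarrow> (\<lambda>z. T (U z) Sab) \<in> O[at q](\<lambda>_. 1)" for q
    by (rule bigo_1_int_shift)
  have 2: "(\<lambda>z. T (U z) Sab) \<in> O[at (q + of_int l * (2 * pi * \<i>))](\<lambda>_. 1) \<longleftrightarrow> (\<lambda>z. T (U z) Sab) \<in> O[at q](\<lambda>_. 1)" for q
    by (rule bigo_1_int_shift) (use T_U_shift_2pi_i in simp)
  have "(\<lambda>z. T (U z) Sab) \<in> O[at (- sum u B + of_int k * \<tau> + of_int l * (2 * pi * \<i>))](\<lambda>_. 1)"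
    unfolding 1 2 by (rule T_U_bigo_base[OF B])
  moreover have "- sum u B + of_int k * \<tau> + of_int l * (2 * pi * \<i>) = p"
    using kl by (simp add: algebra_simps)
  ultimately show ?thesis by (simp only:)
next
  case False
  then have "isCont (\<lambda>z. T (U z) Sab) p"
    using fin by (intro T_isCont good_U U_holo) auto
  then show ?thesis by (rule continuous_imp_bigo_1)
qed

lemma T_U_eq_0:
  assumes "z \<notin> X"
  shows "T (U z) Sab = 0"
proof -
  have "(\<lambda>z. T (U z) Sab) holomorphic_on - X"
    using fin good_U by (intro holomorphic_on_subset[OF T_holo_good] U_holo) auto
  then obtain g where g: "g holomorphic_on UNIV" "\<And>p. ((\<lambda>z. T (U z) Sab) \<longlongrightarrow> g p) (at p)"
      "\<And>z. z \<notin> X \<Longrightarrow> g z = T (U z) Sab"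
    using X_isolated T_U_bigo by (rule entire_extension) blast
  \<comment> \<open>A period of the original function off \<open>X\<close> passes to
    \<open>g\<close>, whose values are limits at every point.\<close>
  have period: "g (p + \<omega>) = g p" if "\<And>z. z \<notin> X \<Longrightarrow> T (U (z + \<omega>)) Sab = T (U z) Sab" for p \<omega>
  proof -
    have "((\<lambda>z. T (U (z + \<omega>)) Sab) \<longlongrightarrow> g (p + \<omega>)) (at p)"
      using g(2)[of "p + \<omega>"] LIM_offset[of "\<lambda>z. T (U z) Sab" "g (p + \<omega>)" "p + \<omega>" \<omega>] by simp
    moreover have "eventually (\<lambda>z. T (U (z + \<omega>)) Sab = T (U z) Sab) (at p)"
      using X_isolated by (rule eventually_mono) (rule that)
    ultimately have "((\<lambda>z. T (U z) Sab) \<longlongrightarrow> g (p + \<omega>)) (at p)"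
      by (rule Lim_transform_eventually)
    then show ?thesis using g(2) LIM_unique by blast
  qed
  have "g z = g 0"
    using g(1) Re_tau period[of \<tau>, OF T_U_shift_tau] period[of "2 * pi * \<i>", OF T_U_shift_2pi_i]
    by (rule entire_doubly_periodic_constant)
  also have "g 0 = 0" using g(2)[of 0] T_U_tendsto_0 LIM_unique by blast
  finally show ?thesis using g(3)[OF assms] by simp
qed

end

section \<open>Removal of the genericity assumption by perturbation\<close>

context theta_like
begin

lemma T_eq_0_step:
  assumes van: "vanishing_below (card S)" and S: "finite S" "2 \<le> card S"
    and u: "sum u S = 0" "good u S"
  shows "T u S = 0"
proof -
  have "\<not> card S \<le> Suc 0" using S(2) by simp
  then obtain a b where ab: "a \<in> S" "b \<in> S" "a \<noteq> b"
    unfolding card_le_Suc0_iff_eq[OF S(1)] by blast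
  define Q where "Q = S - {a, b}"
  have Q: "S = insert a (insert b Q)" "a \<notin> Q" "b \<notin> Q" "finite Q"
    using ab S by (auto simp: Q_def)
  have ub: "u b = - sum u Q - u a" using u(1) Q ab by (simp add: algebra_simps eq_neg_iff_add_eq_0)
  \<comment> \<open>Powers of 2 give different subsets different coefficients of
    \<open>\<epsilon>\<close>, by uniqueness of binary expansions; each difference of subset sums is
    thus nonconstant in \<open>\<epsilon>\<close>.\<close>
  define v where "v \<epsilon> i = u i + \<epsilon> * 2 ^ i" for \<epsilon> :: complex and i :: nat
  \<comment> \<open>The variable at \<open>a\<close> is kept and the one at \<open>b\<close> is
    corrected so that the total stays 0.\<close>
  define W where "W \<epsilon> = (v \<epsilon>)(a := u a, b := - sum (v \<epsilon>) Q - u a)" for \<epsilon>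
  have W0: "W 0 i = u i" for i using ub ab by (auto simp: W_def v_def)
  have W_holo: "(\<lambda>\<epsilon>. W \<epsilon> i) holomorphic_on UNIV" for i
    by (cases "i = a"; cases "i = b") (auto simp: W_def v_def intro!: holomorphic_intros)
  have good0: "good (W 0) S" using u(2) by (simp add: W0[abs_def] good_def)
  have "eventually (\<lambda>\<epsilon>. good (W \<epsilon>) S) (nhds 0)"
    using open_good[of S W] S(1) W_holo good0
    unfolding eventually_nhds by (intro exI[of _ "{z. good (W z) S}"]) simp
  then have ev1: "eventually (\<lambda>\<epsilon>. good (W \<epsilon>) S) (at 0)"
    by (auto simp: eventually_at_filter elim: eventually_mono)
  have sum_v: "sum (v \<epsilon>) B = sum u B + \<epsilon> * of_nat (set_encode B)" if "B \<subseteq> Q" for B \<epsilon>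
    by (simp add: v_def sum.distrib set_encode_def sum_distrib_left)
  have ev2: "eventually (\<lambda>\<epsilon>. \<forall>B\<in>Pow Q. \<forall>C\<in>Pow Q. B \<noteq> C \<longrightarrow> h (sum (v \<epsilon>) B - sum (v \<epsilon>) C) \<noteq> 0) (at 0)"
  proof (intro eventually_ball_finite ballI)
    fix B C assume BC: "B \<in> Pow Q" "C \<in> Pow Q"
    show "eventually (\<lambda>\<epsilon>. B \<noteq> C \<longrightarrow> h (sum (v \<epsilon>) B - sum (v \<epsilon>) C) \<noteq> 0) (at 0)"
    proof (cases "B = C")
      case False
      have "finite B" "finite C" using BC Q by (auto intro: finite_subset)
      then have "set_encode B \<noteq> set_encode C" using False set_encode_eq by blast
      then have "of_nat (set_encode B) - of_nat (set_encode C) \<noteq> (0 :: complex)" by simp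
      then have "eventually (\<lambda>\<epsilon>. h (sum u B - sum u C + \<epsilon> * (of_nat (set_encode B) - of_nat (set_encode C))) \<noteq> 0) (at 0)"
        by (rule h_affine_eventually_nonzero)
      then show ?thesis
        by (rule eventually_mono) (use BC in \<open>auto simp: sum_v algebra_simps\<close>)
    qed simp
  qed (use Q in auto)
  have "eventually (\<lambda>\<epsilon>. T (W \<epsilon>) S = 0) (at 0)"
    using ev1 ev2
  proof eventually_elim
    case (elim \<epsilon>)
    interpret generic_hyperplane h \<tau> c "v \<epsilon>" a b Q
      using Q ab van elim(2) by unfold_locales auto
    have U: "U (u a) = W \<epsilon>" by (simp add: U_def W_def)
    \<comment> \<open>The set \<open>insert a B\<close> misses \<open>b\<close>, so it is proper and
      goodness of the perturbed point places \<open>u a\<close> outside \<open>X\<close>.\<close>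
    have "h (u a + sum (v \<epsilon>) B) \<noteq> 0" if "B \<subseteq> Q" for B
    proof -
      have "insert a B \<subseteq> S" using that Q(1) by blast
      moreover have "b \<in> S - insert a B" using that \<open>b \<in> S\<close> \<open>a \<noteq> b\<close> Q(3) by blast
      ultimately have "insert a B \<subset> S" by blast
      then have "h (sum (W \<epsilon>) (insert a B)) \<noteq> 0" using goodD[OF elim(1)] by blast
      then show ?thesis using sum_U_a[OF that, of "u a"] by (simp add: U)
    qed
    then have "u a \<notin> X" by (auto simp: X_def)
    then show ?case using T_U_eq_0[of "u a"] by (simp add: U Q(1))
  qed
  then have "((\<lambda>\<epsilon>. T (W \<epsilon>) S) \<longlongrightarrow> 0) (at 0)" by (rule tendsto_eventually)
  moreover have "((\<lambda>\<epsilon>. T (W \<epsilon>) S) \<longlongrightarrow> T (W 0) S) (at 0)"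
    using T_isCont[OF S(1) W_holo good0] by (simp add: isCont_def)
  ultimately have "T (W 0) S = 0" using LIM_unique by blast
  then show ?thesis by (simp add: W0[abs_def])
qed

lemma vanishing_below: "vanishing_below n"
proof (induction n)
  case 0
  show ?case by (simp add: vanishing_below_def)
next
  case (Suc n)
  then show ?case
    unfolding vanishing_below_def[of "Suc n"]
    by (metis T_eq_0_step less_Suc_eq vanishing_below_def)
qed

text \<open>Shifting one variable by a multiple of 2 pi i brings the total to 0 without changing
  \<open>T\<close>.\<close>

theorem T_eq_0:
  assumes "finite S" "2 \<le> card S" "good u S" "sum u S = of_int k * (2 * pi * \<i>)"
  shows "T u S = 0"
proof -
  obtain a where a: "a \<in> S" using assms(2) by fastforce
  obtain s where s: "s * s = 1" "\<And>z. h (z + of_int (- k) * (2 * pi * \<i>)) = s * h z"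
    using antiperiod_int[of "- k"] by blast
  define v where "v = u(a := u a + of_int (- k) * (2 * pi * \<i>))"
  have sum_v: "sum v B = sum u B + (if a \<in> B then of_int (- k) * (2 * pi * \<i>) else 0)" if "B \<subseteq> S" for B
    unfolding v_def using that assms(1) by (intro sum_fun_upd_add) (auto intro: finite_subset)
  have "s \<noteq> 0" using s(1) by auto
  then have "good v S" unfolding good_def
    using goodD[OF assms(3)] s(2) sum_v by (auto simp del: of_int_minus)
  moreover have "sum v S = 0" using sum_v[of S] a assms(4) by simp
  ultimately have "T v S = 0"
    using assms(1,2) by (intro T_eq_0_step vanishing_below)
  then show ?thesis unfolding v_def using T_shift_2pi_i[OF assms(1), of u a "- k"] by simp
qed

end

section \<open>The theta function\<close>

lemma convergent_prod_qpoch: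
  assumes "norm q < 1"
  shows "convergent_prod (\<lambda>j. 1 - a * q ^ j :: complex)"
proof -
  have "summable (\<lambda>j. norm a * norm q ^ j)"
    using assms by (intro summable_mult summable_geometric) auto
  then have "summable (\<lambda>j. norm (1 - a * q ^ j - 1))"
    by (simp add: norm_mult norm_power)
  then show ?thesis
    by (intro abs_convergent_prod_imp_convergent_prod summable_imp_abs_convergent_prod)
qed

lemma qpoch_rec:
  assumes "norm q < 1"
  shows "qpoch q a = (1 - a) * qpoch q (a * q)"
proof -
  have "(\<lambda>j. 1 - a * q ^ j) has_prod ((\<Prod>j<1. 1 - a * q ^ j) * (\<Prod>j. 1 - a * q ^ (j + 1)))"
    by (rule has_prod_ignore_initial_segment'[OF convergent_prod_qpoch[OF assms]])
  then show ?thesis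
    by (simp add: qpoch_def has_prod_unique[symmetric] mult_ac)
qed

text \<open>A convergent infinite product vanishes only through one of its factors.\<close>

lemma qpoch_eq_0_imp:
  assumes "norm q < 1" "qpoch q a = 0"
  shows "\<exists>j. a * q ^ j = 1"
  using prodinf_nonzero[OF convergent_prod_qpoch[OF assms(1)], of a] assms(2)
  by (auto simp: qpoch_def)

text \<open>The partial products converge uniformly on discs, by comparison with a geometric
  series.\<close>

lemma qpoch_holomorphic:
  assumes "norm q < 1"
  shows "qpoch q holomorphic_on UNIV"
proof (rule holomorphic_uniform_sequence[where f = "\<lambda>N a. \<Prod>j<N. 1 - a * q ^ j"])
  fix x :: complex
  let ?A = "cball x 1"
  have "uniformly_convergent_on ?A (\<lambda>N a. \<Prod>j<N. 1 - a * q ^ j)"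
  proof (rule uniformly_convergent_on_prod')
    show "uniformly_convergent_on ?A (\<lambda>N a. \<Sum>j<N. norm (1 - a * q ^ j - 1))"
    proof (rule Weierstrass_m_test')
      fix n and a :: complex assume "a \<in> ?A"
      then have "norm a \<le> norm x + 1"
        using norm_triangle_ineq2[of a x] by (simp add: dist_norm norm_minus_commute)
      then show "norm (norm (1 - a * q ^ n - 1)) \<le> (norm x + 1) * norm q ^ n"
        by (simp add: norm_mult norm_power mult_right_mono)
    next
      show "summable (\<lambda>n. (norm x + 1) * norm q ^ n)"
        using assms by (intro summable_mult summable_geometric) auto
    qed
  qed (auto intro!: continuous_intros)
  then obtain g where g: "uniform_limit ?A (\<lambda>N a. \<Prod>j<N. 1 - a * q ^ j) g sequentially"
    by (auto simp: uniformly_convergent_on_def)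
  have "g a = qpoch q a" if "a \<in> ?A" for a
  proof -
    have "(\<lambda>N. \<Prod>j<Suc N. 1 - a * q ^ j) \<longlonglongrightarrow> g a"
      using tendsto_uniform_limitI[OF g that] by (rule LIMSEQ_Suc)
    moreover have "(\<lambda>N. \<Prod>j<Suc N. 1 - a * q ^ j) \<longlonglongrightarrow> qpoch q a"
      using convergent_prod_LIMSEQ[OF convergent_prod_qpoch[OF assms, of a]]
      unfolding lessThan_Suc_atMost qpoch_def .
    ultimately show ?thesis by (rule LIMSEQ_unique)
  qed
  then have "uniform_limit ?A (\<lambda>N a. \<Prod>j<N. 1 - a * q ^ j) g sequentially \<longleftrightarrow>
      uniform_limit ?A (\<lambda>N a. \<Prod>j<N. 1 - a * q ^ j) (qpoch q) sequentially"
    by (intro uniform_limit_cong') auto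
  with g have "uniform_limit ?A (\<lambda>N a. \<Prod>j<N. 1 - a * q ^ j) (qpoch q) sequentially"
    by blast
  then show "\<exists>d>0. cball x d \<subseteq> UNIV \<and> uniform_limit (cball x d) (\<lambda>N a. \<Prod>j<N. 1 - a * q ^ j) (qpoch q) sequentially"
    by (intro exI[of _ 1]) auto
qed (auto intro!: holomorphic_intros)

lemma qpoch_compose_holomorphic:
  assumes "norm q < 1" "f holomorphic_on A"
  shows "(\<lambda>z. qpoch q (f z)) holomorphic_on A"
  using holomorphic_on_compose_gen[OF assms(2) qpoch_holomorphic[OF assms(1)]] by (simp add: o_def)

lemma qpoch_q_nonzero:
  assumes "norm q < 1"
  shows "qpoch q q \<noteq> 0"
proof
  assume "qpoch q q = 0"
  then obtain j where "q * q ^ j = 1" using qpoch_eq_0_imp[OF assms] by blast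
  then have "norm q ^ Suc j = 1" by (metis norm_one norm_power power_Suc)
  moreover have "norm q ^ Suc j \<le> norm q ^ 1" using assms by (intro power_decreasing) auto
  ultimately show False using assms by simp
qed

lemma thetaD_holomorphic:
  assumes "norm q < 1"
  shows "thetaD q k holomorphic_on - {0}"
proof (induction k)
  case 0
  have "theta q holomorphic_on - {0}"
    unfolding theta_def using qpoch_q_nonzero[OF assms]
    by (intro holomorphic_intros qpoch_compose_holomorphic[OF assms]) auto
  then show ?case by simp
next
  case (Suc k)
  then show ?case by (auto intro!: holomorphic_intros)
qed

text \<open>Under \<open>x = exp z\<close>, with square root \<open>exp (z / 2)\<close>, the
  operator x d/dx becomes d/dz.\<close>

lemma thetaD_exp:
  assumes "norm q < 1"
  shows "thetaD q k (exp (z / 2)) = (deriv ^^ k) (\<lambda>z. theta q (exp (z / 2))) z"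
proof (induction k arbitrary: z)
  case (Suc k)
  have "(thetaD q k has_field_derivative deriv (thetaD q k) (exp (z / 2))) (at (exp (z / 2)))"
    using thetaD_holomorphic[OF assms, of k] by (intro holomorphic_derivI[of _ "- {0}"]) auto
  then have "((\<lambda>z. thetaD q k (exp (z / 2))) has_field_derivative
      deriv (thetaD q k) (exp (z / 2)) * (exp (z / 2) * (1 / 2))) (at z)"
    by (rule DERIV_chain2) (auto intro!: derivative_eq_intros)
  then have "deriv (\<lambda>z. thetaD q k (exp (z / 2))) z = thetaD q (Suc k) (exp (z / 2))"
    by (simp add: DERIV_imp_deriv)
  then show ?case by (simp add: Suc.IH)
qed simp

lemma exp_eq_1_imp: "exp z = 1 \<Longrightarrow> \<exists>l :: int. z = of_int l * (2 * pi * \<i>)"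
  using exp_eq[of z 0] by (auto simp: algebra_simps)

lemma theta_exp:
  "theta q (exp (z / 2)) =
    (exp (z / 2) - exp (- (z / 2))) * (qpoch q (q * exp z) * qpoch q (q * exp (- z))) / (qpoch q q)\<^sup>2"
  by (simp add: theta_def exp_minus field_simps flip: exp_double)

text \<open>The quasi-period is the principal logarithm of q; its real part is ln |q|, nonzero
  because 0 < |q| < 1.\<close>

lemma theta_like_theta:
  assumes "q \<noteq> 0" "norm q < 1"
  shows "theta_like (\<lambda>z. theta q (exp (z / 2))) (Ln q) (- 1 / exp (Ln q / 2))"
proof
  let ?K = "\<lambda>z. qpoch q (q * exp z) * qpoch q (q * exp (- z))"
  have expLn: "exp (Ln q) = q" using assms by simp
  show "(\<lambda>z. theta q (exp (z / 2))) holomorphic_on UNIV"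
    unfolding theta_exp using qpoch_q_nonzero[OF assms(2)]
    by (intro holomorphic_intros qpoch_compose_holomorphic[OF assms(2)]) auto
  show "theta q (exp (- z / 2)) = - theta q (exp (z / 2))" for z
    unfolding theta_exp by (simp add: algebra_simps diff_divide_distrib)
  show "deriv (\<lambda>z. theta q (exp (z / 2))) 0 = 1"
  proof -
    have "?K holomorphic_on UNIV"
      by (intro holomorphic_intros qpoch_compose_holomorphic[OF assms(2)])
    then have "(?K has_field_derivative deriv ?K 0) (at 0)" by (intro holomorphic_derivI) auto
    moreover have "((\<lambda>z :: complex. exp (z / 2) - exp (- (z / 2))) has_field_derivative 1) (at 0)"
      by (auto intro!: derivative_eq_intros)
    \<comment> \<open>The first factor vanishes at 0 with derivative 1, so only the value of
      \<open>?K\<close> at 0 survives; it is cancelled by the normalization of Theta.\<close>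
    ultimately have "((\<lambda>z. (exp (z / 2) - exp (- (z / 2))) * ?K z) has_field_derivative
       1 * ?K 0 + deriv ?K 0 * (exp (0 / 2) - exp (- (0 / 2)))) (at 0)"
      by (intro DERIV_mult)
    then have "((\<lambda>z. (exp (z / 2) - exp (- (z / 2))) * ?K z / (qpoch q q)\<^sup>2) has_field_derivative
       (1 * ?K 0 + deriv ?K 0 * (exp (0 / 2) - exp (- (0 / 2)))) / (qpoch q q)\<^sup>2) (at 0)"
      by (rule DERIV_cdivide)
    then show ?thesis
      unfolding theta_exp using qpoch_q_nonzero[OF assms(2)]
      by (simp add: DERIV_imp_deriv power2_eq_square)
  qed
  show "theta q (exp ((z + 2 * pi * \<i>) / 2)) = - theta q (exp (z / 2))" for z
  proof -
    have "exp ((z + 2 * pi * \<i>) / 2) = - exp (z / 2)" by (simp add: add_divide_distrib exp_add)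
    moreover have "- x - 1 / - x = - (x - 1 / x)" for x :: complex by simp
    ultimately show ?thesis unfolding theta_def by (simp only: power2_minus mult_minus_left minus_divide_left)
  qed
  show "theta q (exp ((z + Ln q) / 2)) = - 1 / exp (Ln q / 2) * exp (- z) * theta q (exp (z / 2))" for z
  proof -
    define x where "x = exp (z / 2)"
    define r where "r = exp (Ln q / 2)"
    have nz: "x \<noteq> 0" "r \<noteq> 0" by (auto simp: x_def r_def)
    have r2: "q = r\<^sup>2" using expLn by (simp add: r_def flip: exp_double)
    have x2: "exp z = x\<^sup>2" by (simp add: x_def flip: exp_double)
    \<comment> \<open>Multiplying x by q drops a factor from one infinite product and adds one to
      the other; \<open>A\<close> and \<open>B\<close> isolate these two factors.\<close>
    have A: "qpoch q (q * x\<^sup>2) = (1 - q * x\<^sup>2) * qpoch q (q * x\<^sup>2 * q)"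
      by (rule qpoch_rec[OF assms(2)])
    have B: "qpoch q (1 / x\<^sup>2) = (1 - 1 / x\<^sup>2) * qpoch q (q / x\<^sup>2)"
      using qpoch_rec[OF assms(2), of "1 / x\<^sup>2"] by (simp only: times_divide_eq_left mult_1)
    have "theta q (x * r) = (x * r - 1 / (x * r)) * qpoch q (q * (x * r)\<^sup>2) * qpoch q (q / (x * r)\<^sup>2) / (qpoch q q)\<^sup>2"
      by (simp add: theta_def)
    also have "q * (x * r)\<^sup>2 = q * x\<^sup>2 * q" by (simp add: r2 power_mult_distrib)
    also have "q / (x * r)\<^sup>2 = 1 / x\<^sup>2" using nz by (simp add: r2 power_mult_distrib)
    also have "(x * r - 1 / (x * r)) * qpoch q (q * x\<^sup>2 * q) * qpoch q (1 / x\<^sup>2) / (qpoch q q)\<^sup>2 =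
      - 1 / r * (1 / x\<^sup>2) * ((x - 1 / x) * qpoch q (q * x\<^sup>2) * qpoch q (q / x\<^sup>2) / (qpoch q q)\<^sup>2)"
    proof -
      have "(x * r - 1 / (x * r)) * (1 - 1 / x\<^sup>2) = - 1 / r * (1 / x\<^sup>2) * (x - 1 / x) * (1 - q * x\<^sup>2)"
        using nz by (simp add: r2 field_simps power2_eq_square)
      moreover have "L * a * (M * b) / K = R * (W * (N * a) * b / K)"
        if "L * M = R * W * N" for L M N R W a b K :: complex
      proof -
        have "L * a * (M * b) / K = (L * M) * (a * b / K)" by simp
        then show ?thesis unfolding that by simp
      qed
      ultimately show ?thesis unfolding A B by blast
    qed
    also have "\<dots> = - 1 / r * exp (- z) * theta q x"
      by (simp add: theta_def x2 exp_minus inverse_eq_divide)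
    finally show ?thesis by (simp add: x_def r_def add_divide_distrib exp_add)
  qed
  show "- 1 / exp (Ln q / 2) \<noteq> 0" by simp
  show "Re (Ln q) \<noteq> 0" using assms by simp
  show "\<exists>k l :: int. z = of_int k * Ln q + of_int l * (2 * pi * \<i>)" if zero: "theta q (exp (z / 2)) = 0" for z
  proof -
    have Lnpow: "q * q ^ j = exp (of_nat (Suc j) * Ln q)" for j
      using expLn by (simp only: exp_of_nat_mult power_Suc)
    \<comment> \<open>A zero of Theta comes from the elementary factor or from one of the two
      infinite products; these give the lattice points with \<open>k\<close> zero, negative and
      positive respectively.\<close>
    consider "exp (z / 2) = exp (- (z / 2))" | "qpoch q (q * exp z) = 0" | "qpoch q (q * exp (- z)) = 0"
      using zero qpoch_q_nonzero[OF assms(2)] unfolding theta_exp by auto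
    then show ?thesis
    proof cases
      case 1
      have "exp z = exp (z / 2) * exp (z / 2)" by (simp flip: exp_add)
      also have "\<dots> = exp (- (z / 2)) * exp (z / 2)" by (simp only: 1)
      also have "\<dots> = 1" by (simp flip: exp_add)
      finally obtain l :: int where "z = of_int l * (2 * pi * \<i>)" using exp_eq_1_imp by blast
      then show ?thesis by (intro exI[of _ 0] exI[of _ l]) simp
    next
      case 2
      then obtain j where j: "q * exp z * q ^ j = 1" using qpoch_eq_0_imp[OF assms(2)] by blast
      have "exp (z + of_nat (Suc j) * Ln q) = exp z * (q * q ^ j)"
        by (simp only: exp_add Lnpow)
      also have "\<dots> = 1" using j by (simp add: mult_ac)
      finally have "exp (z + of_nat (Suc j) * Ln q) = 1" .
      then obtain l :: int where l: "z + of_nat (Suc j) * Ln q = of_int l * (2 * pi * \<i>)"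
        using exp_eq_1_imp by blast
      then have "z = of_int (- int (Suc j)) * Ln q + of_int l * (2 * pi * \<i>)"
        unfolding l[symmetric] by (simp add: algebra_simps)
      then show ?thesis by blast
    next
      case 3
      then obtain j where j: "q * exp (- z) * q ^ j = 1" using qpoch_eq_0_imp[OF assms(2)] by blast
      have "exp (- z + of_nat (Suc j) * Ln q) = exp (- z) * (q * q ^ j)"
        by (simp only: exp_add Lnpow)
      also have "\<dots> = 1" using j by (simp add: mult_ac)
      finally have "exp (- z + of_nat (Suc j) * Ln q) = 1" .
      then obtain l :: int where l: "- z + of_nat (Suc j) * Ln q = of_int l * (2 * pi * \<i>)"
        using exp_eq_1_imp by blast
      then have "z = of_int (int (Suc j)) * Ln q + of_int (- l) * (2 * pi * \<i>)"
        unfolding of_int_minus mult_minus_left l[symmetric] by (simp add: algebra_simps)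
      then show ?thesis by blast
    qed
  qed
qed

text \<open>\<open>s i\<close> is the chosen square root of t_i. The last assumption selects the
  points of the hypersurface where no denominator of the defining formula vanishes.\<close>

theorem theorem11p2:
  fixes q :: complex and n :: nat and s :: "nat \<Rightarrow> complex"
  assumes "q \<noteq> 0" and "norm q < 1"
    and "n \<ge> 2"
    and "\<forall>i<n. s i \<noteq> 0"
    and "(\<Prod>i<n. (s i)\<^sup>2) = 1"
    and "\<forall>\<sigma>. \<sigma> permutes {..<n} \<longrightarrow> (\<forall>m\<in>{1..<n}. theta q (pprod s \<sigma> m) \<noteq> 0)"
  shows "Tfun q n s = 0"
proof -
  define h where "h = (\<lambda>z. theta q (exp (z / 2)))"
  \<comment> \<open>Any logarithm of t_i would fix only its own square root; twice the logarithm of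
    \<open>s i\<close> makes \<open>exp (u i / 2)\<close> the chosen one.\<close>
  define u where "u i = 2 * Ln (s i)" for i
  interpret theta_like h "Ln q" "- 1 / exp (Ln q / 2)"
    unfolding h_def by (rule theta_like_theta) fact+
  have s: "s i = exp (u i / 2)" if "i < n" for i
    using assms(4) that by (simp add: u_def)
  have p: "pprod s \<sigma> m = exp ((\<Sum>x\<leftarrow>take m (map \<sigma> [0..<n]). u x) / 2)"
    if "\<sigma> permutes {..<n}" "m \<le> n" for \<sigma> m
  proof -
    have "pprod s \<sigma> m = (\<Prod>k<m. exp (u (\<sigma> k) / 2))"
      unfolding pprod_def using that permutes_in_image[OF that(1)]
      by (intro prod.cong refl s) auto
    also have "\<dots> = exp ((\<Sum>k<m. u (\<sigma> k)) / 2)" by (simp add: exp_sum sum_divide_distrib)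
    also have "(\<Sum>k<m. u (\<sigma> k)) = (\<Sum>x\<leftarrow>take m (map \<sigma> [0..<n]). u x)"
      using that(2) by (simp add: take_map take_upt sum_list_distinct_conv_sum_set o_def atLeast0LessThan)
    finally show ?thesis .
  qed
  have "Tfun q n s = (\<Sum>\<sigma> | \<sigma> permutes {..<n}. V u (map \<sigma> [0..<n]))"
    unfolding Tfun_def
  proof (intro sum.cong refl)
    fix \<sigma> assume "\<sigma> \<in> {\<sigma>. \<sigma> permutes {..<n}}"
    then have \<sigma>: "\<sigma> permutes {..<n}" by simp
    define xs where "xs = map \<sigma> [0..<n]"
    have len: "length xs = n" by (simp add: xs_def)
    then have "xs \<noteq> []" using assms(3) by auto
    have hp: "theta q (pprod s \<sigma> m) = h (\<Sum>x\<leftarrow>take m xs. u x)" if "m \<le> n" for m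
      using p[OF \<sigma> that] by (simp add: h_def xs_def)
    have nz: "h (\<Sum>x\<leftarrow>take m xs. u x) \<noteq> 0" if "1 \<le> m" "m < n" for m
      using assms(6) \<sigma> that hp[of m] by auto
    have "Tmat q n s \<sigma> = mat n n (\<lambda>(i, j). if i \<le> j + 1
       then (deriv ^^ (j + 1 - i)) h (\<Sum>x\<leftarrow>take (n - (j + 1)) xs. u x) / fact (j + 1 - i) else 0)"
      unfolding Tmat_def using p[OF \<sigma>] thetaD_exp[OF assms(2)]
      by (intro cong_mat refl) (auto simp: h_def xs_def)
    then have "det (Tmat q n s \<sigma>) = V u xs * (\<Prod>m\<in>{1..<n}. h (\<Sum>x\<leftarrow>take m xs. u x))"
      using det_eq_V[of xs u, unfolded len, OF \<open>xs \<noteq> []\<close> nz] by (simp only:)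
    moreover have "(\<Prod>m\<in>{1..<n}. theta q (pprod s \<sigma> m)) = (\<Prod>m\<in>{1..<n}. h (\<Sum>x\<leftarrow>take m xs. u x))"
      using hp by (intro prod.cong) auto
    moreover have "(\<Prod>m\<in>{1..<n}. h (\<Sum>x\<leftarrow>take m xs. u x)) \<noteq> 0"
      using nz by auto
    ultimately show "det (Tmat q n s \<sigma>) / (\<Prod>m\<in>{1..<n}. theta q (pprod s \<sigma> m)) = V u xs"
      by simp
  qed
  also have "\<dots> = T u {..<n}"
    by (simp add: sum_permutes_permutations_of_set[of "V u"] T_eq_sum_V)
  also have "\<dots> = 0"
  proof -
    have "exp (sum u {..<n}) = (\<Prod>i<n. (s i)\<^sup>2)"
      by (simp add: exp_sum s flip: exp_double)
    \<comment> \<open>The logarithms add up to 0 only modulo 2 pi i, and the product of the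
      \<open>s i\<close> may be -1; hence the integer \<open>k\<close>.\<close>
    then obtain k :: int where k: "sum u {..<n} = of_int k * (2 * pi * \<i>)"
      using assms(5) exp_eq_1_imp by metis
    have "good u {..<n}" unfolding good_def
    proof (intro allI impI)
      fix B assume B: "B \<subset> {..<n}" "B \<noteq> {}"
      then have fin: "finite B" by (auto intro: finite_subset)
      obtain xs where xs: "set xs = B" "distinct xs" using finite_distinct_list[OF fin] by blast
      obtain ys where ys: "set ys = {..<n} - B" "distinct ys" using finite_distinct_list[of "{..<n} - B"] by blast
      \<comment> \<open>Listing \<open>B\<close> first makes \<open>sum u B\<close> the logarithm of
        a partial product that the assumption on denominators covers.\<close>
      have "xs @ ys \<in> permutations_of_set {..<n}" using xs ys B by (auto simp: permutations_of_set_def)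
      then obtain \<sigma> where \<sigma>: "\<sigma> permutes {..<n}" "map \<sigma> [0..<n] = xs @ ys"
        using image_permutes_permutations_of_set(2)[of n] by (metis (mono_tags, lifting) imageE mem_Collect_eq)
      have c: "length xs = card B" using xs distinct_card by force
      have "card B < n" using B psubset_card_mono[of "{..<n}" B] by simp
      moreover have "card B \<ge> 1" using B fin by (simp add: Suc_le_eq card_gt_0_iff)
      ultimately have "theta q (pprod s \<sigma> (card B)) \<noteq> 0" using assms(6) \<sigma>(1) by simp
      moreover have "(\<Sum>x\<leftarrow>take (card B) (map \<sigma> [0..<n]). u x) = sum u B"
        using xs by (simp add: \<sigma>(2) c[symmetric] sum_list_distinct_conv_sum_set)
      ultimately show "h (sum u B) \<noteq> 0"
        using p[OF \<sigma>(1), of "card B"] \<open>card B < n\<close> by (simp add: h_def)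
    qed
    then show ?thesis using k assms(3) by (intro T_eq_0[of _ _ k]) auto
  qed
  finally show ?thesis .
qed

end
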